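(* Let $M$ be a connected complex manifold, $\lambda_0\in M$, and let $f_{\lambda_0}:W\to\mathbb{P}^1$, with $W\subset\mathbb{P}^1$ a non-empty open set, be an Ahlfors island map such that $\partial W$ is totally disconnected. Assume that there are quasiconformal homeomorphisms $\varphi_\lambda,\psi_\lambda,\tilde\varphi_\lambda,\tilde\psi_\lambda$ of $\mathbb{P}^1$, depending holomorphically on $\lambda\in M$, such that for all $\lambda\in M$ $$f_\lambda:=\varphi_\lambda\circ f_{\lambda_0}\circ\psi_\lambda^{-1}=\tilde\varphi_\lambda\circ f_{\lambda_0}\circ\tilde\psi_\lambda^{-1}.$$ Then for all $\lambda\in M$, $\varphi_\lambda=\tilde\varphi_\lambda$ on $S(f_{\lambda_0})$.
   Context: Ahlfors island map: let $X$ be a compact Riemann surface, $W\subset X$ a non-empty open set, $f:W\to X$ holomorphic. $f$ has the $N$-island property if for any $N$ Jordan domains $D_1,\dots,D_N\subset X$ with pairwise disjoint closures and any open set $U$ intersecting $\partial W$ (boundary in $X$), there exist $1\le i\le N$ and an open set $\Omega\Subset U\cap W$ such that $f:\Omega\to D_i$ is a conformal isomorphism. $f$ is an Ahlfors island map if it has the $N$-island property for some $N\ge1$. Here $X=\mathbb{P}^1$ is the Riemann sphere. Singular values: a critical value is the image of a point where $f'=0$; an asymptotic value is a point $v\in X$ for which there is a curve $\gamma:\mathbb{R}_+\to W$ with $\gamma(t)\to\partial W$ and $f(\gamma(t))\to v$ as $t\to\infty$. A singular value is any limit point of a (possibly constant) sequence of critical or asymptotic values, and $S(f)$ denotes the set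 of all singular values of $f$. The equality of the two expressions for $f_\lambda$ is an equality of partially defined maps, so in particular the domains agree: $\psi_\lambda(W)=\tilde\psi_\lambda(W)$.
   Formalization: The formal theorem also assumes that φ and φ̃ agree at the base point λ₀; without this the claim fails, e.g. for f=exp on ℂ with φ=ψ=id, φ̃=1/z, ψ̃=−z (all constant in λ), where φ̃ swaps S(f)={0,∞}. *)

theory Defs
  imports "HOL-Complex_Analysis.Complex_Analysis"
begin

section \<open>The Riemann sphere\<close>

text \<open>The point at infinity is \<open>None\<close>.\<close>

abbreviation P1 :: "complex option topology" where
  "P1 \<equiv> Alexandroff_compactification euclidean"

lemma topspace_P1: "topspace P1 = UNIV"
  by (auto simp: UNIV_option_conv)

text \<open>The two standard charts \<open>z\<close> and \<open>1/z\<close>, each paired with its domain. Values of a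
  coordinate function outside of the domain of the chart are irrelevant.\<close>

definition P1_charts :: "(complex option set \<times> (complex option \<Rightarrow> complex)) set" where
  "P1_charts = {(range Some, the),
     (- {Some 0}, \<lambda>z. case z of None \<Rightarrow> 0 | Some w \<Rightarrow> inverse w)}"

definition P1_holomorphic_on ::
    "(complex option \<Rightarrow> complex option) \<Rightarrow> complex option set \<Rightarrow> bool" where
  "P1_holomorphic_on f W \<longleftrightarrow>
     openin P1 W \<and> continuous_map (subtopology P1 W) P1 f \<and>
     (\<forall>(U, c)\<in>P1_charts. \<forall>(V, d)\<in>P1_charts.
        (d \<circ> f \<circ> inv_into U c) holomorphic_on c ` {z \<in> U \<inter> W. f z \<in> V})"

definition conformal_iso ::
    "(complex option \<Rightarrow> complex option) \<Rightarrow> complex option set \<Rightarrow> complex option set \<Rightarrow> bool" where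
  "conformal_iso f \<Omega> D \<longleftrightarrow> bij_betw f \<Omega> D \<and> P1_holomorphic_on f \<Omega> \<and>
     P1_holomorphic_on (inv_into \<Omega> f) D"

definition jordan_curve :: "complex option set \<Rightarrow> bool" where
  "jordan_curve J \<longleftrightarrow>
     subtopology P1 J homeomorphic_space top_of_set (sphere (0 :: complex) 1)"

text \<open>An open connected set whose boundary is a Jordan curve \<open>J\<close> is one of
  the two components of the complement of \<open>J\<close>.\<close>

definition jordan_domain :: "complex option set \<Rightarrow> bool" where
  "jordan_domain D \<longleftrightarrow> openin P1 D \<and> connectedin P1 D \<and> jordan_curve (P1 frontier_of D)"

definition totally_disconnected_in :: "'a topology \<Rightarrow> 'a set \<Rightarrow> bool" where
  "totally_disconnected_in X S \<longleftrightarrow>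
     S \<subseteq> topspace X \<and> (\<forall>C \<subseteq> S. connectedin X C \<longrightarrow> (\<exists>a. C \<subseteq> {a}))"


section \<open>Ahlfors island maps\<close>

text \<open>Since \<open>P1\<close> is compact, \<open>\<Omega>\<close> is relatively compact in \<open>U \<inter> W\<close> iff its closure
  in \<open>P1\<close> is contained in \<open>U \<inter> W\<close>.\<close>

definition island_property ::
    "nat \<Rightarrow> complex option set \<Rightarrow> (complex option \<Rightarrow> complex option) \<Rightarrow> bool" where
  "island_property N W f \<longleftrightarrow>
     (\<forall>D U. (\<forall>i\<in>{1..N}. jordan_domain (D i)) \<and>
            (\<forall>i\<in>{1..N}. \<forall>j\<in>{1..N}. i \<noteq> j \<longrightarrow>
               disjnt (P1 closure_of D i) (P1 closure_of D j)) \<and>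
            openin P1 U \<and> U \<inter> (P1 frontier_of W) \<noteq> {} \<longrightarrow>
        (\<exists>i\<in>{1..N}. \<exists>\<Omega>. openin P1 \<Omega> \<and> P1 closure_of \<Omega> \<subseteq> U \<inter> W \<and>
            conformal_iso f \<Omega> (D i)))"

definition Ahlfors_island_map ::
    "complex option set \<Rightarrow> (complex option \<Rightarrow> complex option) \<Rightarrow> bool" where
  "Ahlfors_island_map W f \<longleftrightarrow>
     openin P1 W \<and> W \<noteq> {} \<and> P1_holomorphic_on f W \<and> (\<exists>N\<ge>1. island_property N W f)"


section \<open>Singular values\<close>

text \<open>Vanishing of the derivative does not depend on the charts around \<open>z\<close> and \<open>f z\<close>.\<close>

definition critical_values ::
    "complex option set \<Rightarrow> (complex option \<Rightarrow> complex option) \<Rightarrow> complex option set" where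
  "critical_values W f =
     {f z | z. z \<in> W \<and>
        (\<exists>(U, c)\<in>P1_charts. \<exists>(V, d)\<in>P1_charts. z \<in> U \<and> f z \<in> V \<and>
           deriv (d \<circ> f \<circ> inv_into U c) (c z) = 0)}"

definition asymptotic_values ::
    "complex option set \<Rightarrow> (complex option \<Rightarrow> complex option) \<Rightarrow> complex option set" where
  "asymptotic_values W f =
     {v. \<exists>\<gamma> :: real \<Rightarrow> complex option.
        continuous_map (top_of_set {0..}) (subtopology P1 W) \<gamma> \<and>
        (\<forall>G. openin P1 G \<and> P1 frontier_of W \<subseteq> G \<longrightarrow> (\<forall>\<^sub>F t in at_top. \<gamma> t \<in> G)) \<and>
        limitin P1 (f \<circ> \<gamma>) v at_top}"

definition singular_values ::
    "complex option set \<Rightarrow> (complex option \<Rightarrow> complex option) \<Rightarrow> complex option set" where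
  "singular_values W f =
     {v. \<exists>s :: nat \<Rightarrow> complex option.
        range s \<subseteq> critical_values W f \<union> asymptotic_values W f \<and> limitin P1 s v sequentially}"


section \<open>Quasiconformal homeomorphisms\<close>

text \<open>The analytic definition: a homeomorphism that is absolutely continuous on lines (ACL)
  and satisfies \<open>\<bar>f\<^sub>z\<^sub>b\<^sub>a\<^sub>r\<bar> \<le> k \<bar>f\<^sub>z\<bar>\<close> almost everywhere for some \<open>k < 1\<close>; on the sphere
  this is required in the charts. In particular such maps preserve the orientation.\<close>

definition abs_continuous_on_interval :: "real \<Rightarrow> real \<Rightarrow> (real \<Rightarrow> complex) \<Rightarrow> bool" where
  "abs_continuous_on_interval a b g \<longleftrightarrow>
     (\<forall>\<epsilon>>0. \<exists>\<delta>>0. \<forall>I. finite I \<and> (\<forall>(l, u)\<in>I. a \<le> l \<and> l \<le> u \<and> u \<le> b) \<and>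
        pairwise (\<lambda>p q. disjnt {fst p<..<snd p} {fst q<..<snd q}) I \<and>
        (\<Sum>(l, u)\<in>I. u - l) < \<delta> \<longrightarrow>
        (\<Sum>(l, u)\<in>I. norm (g u - g l)) < \<epsilon>)"

definition ACL_on :: "(complex \<Rightarrow> complex) \<Rightarrow> complex set \<Rightarrow> bool" where
  "ACL_on g S \<longleftrightarrow>
     (\<forall>a b c d. a < b \<and> c < d \<and> cbox (Complex a c) (Complex b d) \<subseteq> S \<longrightarrow>
        (AE y in lborel. y \<in> {c..d} \<longrightarrow> abs_continuous_on_interval a b (\<lambda>x. g (Complex x y))) \<and>
        (AE x in lborel. x \<in> {a..b} \<longrightarrow> abs_continuous_on_interval c d (\<lambda>y. g (Complex x y))))"

text \<open>With \<open>p = \<partial>g/\<partial>x\<close> and \<open>q = \<partial>g/\<partial>y\<close>, the derivatives with respect to \<open>z\<close> and to its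
  conjugate are \<open>(p - \<i> q)/2\<close> and \<open>(p + \<i> q)/2\<close>.\<close>

definition dilatation_bound_on :: "real \<Rightarrow> (complex \<Rightarrow> complex) \<Rightarrow> complex set \<Rightarrow> bool" where
  "dilatation_bound_on k g S \<longleftrightarrow>
     (AE z in lborel. z \<in> S \<longrightarrow>
        (\<exists>p q. ((\<lambda>t. g (z + of_real t)) has_vector_derivative p) (at 0) \<and>
               ((\<lambda>t. g (z + \<i> * of_real t)) has_vector_derivative q) (at 0) \<and>
               norm ((p + \<i> * q) / 2) \<le> k * norm ((p - \<i> * q) / 2)))"

definition quasiconformal :: "(complex option \<Rightarrow> complex option) \<Rightarrow> bool" where
  "quasiconformal \<phi> \<longleftrightarrow> homeomorphic_map P1 P1 \<phi> \<and>
     (\<exists>k. 0 \<le> k \<and> k < 1 \<and>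
        (\<forall>(U, c)\<in>P1_charts. \<forall>(V, d)\<in>P1_charts.
           ACL_on (d \<circ> \<phi> \<circ> inv_into U c) (c ` {z \<in> U. \<phi> z \<in> V}) \<and>
           dilatation_bound_on k (d \<circ> \<phi> \<circ> inv_into U c) (c ` {z \<in> U. \<phi> z \<in> V})))"


section \<open>Complex manifolds and holomorphic dependence on parameters\<close>

text \<open>Holomorphic functions of several variables on an open set, via complex linearity of the
  total derivative.\<close>

definition several_holomorphic_on ::
    "(complex ^ 'n \<Rightarrow> complex) \<Rightarrow> (complex ^ 'n) set \<Rightarrow> bool" where
  "several_holomorphic_on g S \<longleftrightarrow>
     (\<forall>z\<in>S. \<exists>D. (g has_derivative D) (at z) \<and> (\<forall>a v. D (a *s v) = a * D v))"

text \<open>A complex manifold of dimension \<open>CARD('n)\<close>: a topology together with an atlas, whose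
  charts are pairs of a domain and a coordinate map.\<close>

definition complex_manifold ::
    "'m topology \<Rightarrow> ('m set \<times> ('m \<Rightarrow> complex ^ 'n)) set \<Rightarrow> bool" where
  "complex_manifold M \<A> \<longleftrightarrow>
     Hausdorff_space M \<and> second_countable M \<and>
     (\<Union>(U, c)\<in>\<A>. U) = topspace M \<and>
     (\<forall>(U, c)\<in>\<A>. openin M U \<and> open (c ` U) \<and>
        homeomorphic_map (subtopology M U) (top_of_set (c ` U)) c) \<and>
     (\<forall>(U, c)\<in>\<A>. \<forall>(V, d)\<in>\<A>. \<forall>i.
        several_holomorphic_on (\<lambda>w. (d \<circ> inv_into U c) w $ i) (c ` (U \<inter> V)))"

definition manifold_holomorphic_P1 ::
    "'m topology \<Rightarrow> ('m set \<times> ('m \<Rightarrow> complex ^ 'n)) set \<Rightarrow> ('m \<Rightarrow> complex option) \<Rightarrow> bool" where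
  "manifold_holomorphic_P1 M \<A> g \<longleftrightarrow>
     continuous_map M P1 g \<and>
     (\<forall>(U, c)\<in>\<A>. \<forall>(V, d)\<in>P1_charts.
        several_holomorphic_on (d \<circ> g \<circ> inv_into U c) (c ` {x \<in> U. g x \<in> V}))"

text \<open>Holomorphic dependence is pointwise: \<open>\<lambda> \<mapsto> \<phi>\<^sub>\<lambda>(z)\<close> is holomorphic for every \<open>z\<close>, as
  for holomorphic motions.\<close>

definition holomorphic_qc_family ::
    "'m topology \<Rightarrow> ('m set \<times> ('m \<Rightarrow> complex ^ 'n)) set \<Rightarrow>
     ('m \<Rightarrow> complex option \<Rightarrow> complex option) \<Rightarrow> bool" where
  "holomorphic_qc_family M \<A> \<phi> \<longleftrightarrow>
     (\<forall>l\<in>topspace M. quasiconformal (\<phi> l)) \<and>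
     (\<forall>z. manifold_holomorphic_P1 M \<A> (\<lambda>l. \<phi> l z))"

end

theory Submission
  imports Defs
begin

text \<open>
  Put \<open>g\<^sub>l = inv (\<phi>'\<^sub>l) \<circ> \<phi>\<^sub>l\<close> and \<open>h\<^sub>l = inv (\<psi>'\<^sub>l) \<circ> \<psi>\<^sub>l\<close>. The equality of the two
  expressions of \<open>f\<^sub>l\<close> means that the homeomorphism \<open>h\<^sub>l\<close> of the sphere preserves \<open>W\<close> and that
  \<open>g\<^sub>l \<circ> f = f \<circ> h\<^sub>l\<close> on \<open>W\<close>; the claim is that \<open>g\<^sub>l\<close> fixes the singular values of \<open>f\<close>. At the base point \<open>g\<close> is the identity
  and \<open>M\<close> is connected, so it suffices to show that \<open>g\<^sub>l v\<close> is locally constant in \<open>l\<close> when \<open>v\<close>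
  is a critical or an asymptotic value; limits of such values follow by continuity. The argument
  is topological in \<open>l\<close>: it rests on the joint continuity of \<open>g\<^sub>l z\<close> and \<open>h\<^sub>l z\<close> in \<open>(l, z)\<close>.

  Joint continuity (\<open>motion_continuous\<close>, \<open>motion_inverse_continuous\<close>) is the continuity part of
  the \<open>\<lambda>\<close>-lemma for holomorphic motions. Along a holomorphic disc in \<open>M\<close>, the cross ratio of four
  moving points is a holomorphic function omitting \<open>0\<close> and \<open>1\<close>. By Schottky's theorem such a
  function stays small on a smaller disc, uniformly, if it is small at the centre; hence points
  that start close together remain close.

  Critical values (\<open>critical_value_fixed\<close>): a point is critical iff \<open>f\<close> is injective in no
  neighbourhood of it. This is a topological property, so \<open>h\<^sub>l\<close> maps critical points to critical
  points. Near a critical point \<open>f\<close> takes only one value at critical points. So if \<open>z\<close> is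
  critical, \<open>g\<^sub>l (f z) = f (h\<^sub>l z)\<close> is locally constant in \<open>l\<close>.

  Asymptotic values (\<open>asymptotic_value_fixed\<close>): a curve \<open>\<gamma>\<close> with asymptotic value \<open>v\<close> converges to
  a single point \<open>x\<close> of the totally disconnected boundary of \<open>W\<close>, and \<open>h\<^sub>l x\<close> stays in this
  boundary, so it is a point \<open>x'\<close> that does not depend on \<open>l\<close>. Along a short path from \<open>k\<close> to \<open>m\<close>
  in \<open>M\<close> the curves \<open>h\<^sub>l \<circ> \<gamma>\<close> form a homotopy between two curves ending at \<open>x'\<close>. On this homotopy
  \<open>f\<close> is bounded in a chart, since \<open>f \<circ> h\<^sub>l \<circ> \<gamma> = g\<^sub>l \<circ> f \<circ> \<gamma>\<close> is close to \<open>g\<^sub>k v\<close>, and at the two ends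
  \<open>f\<close> has the limits \<open>g\<^sub>k v\<close> and \<open>g\<^sub>m v\<close>. A theorem in the spirit of Lindelof
  (\<open>lindelof_two_limits_homotopic\<close>) says that these limits coincide.

  For this theorem, pass to a logarithmic coordinate at the end point, so that the curves go to
  the left. Let \<open>q0 \<noteq> q1\<close> be the two limits of a bounded holomorphic function \<open>F\<close>. The set of points
  around which the boundary of a long piece of the homotopy winds is covered by the homotopy,
  and its boundary lies on that curve. The maximum principle, with a harmonic majorant
  as in the theorem of Phragmen and Lindelof, shows that \<open>(F - q0) (F - q1)\<close> is small on the part
  of this set on a vertical line far to the left. So there \<open>F\<close> is close to \<open>q0\<close> or to \<open>q1\<close>, which
  contradicts the crossing lemma \<open>vertical_line_meets_inside_between\<close>.
\<close>

section \<open>Limits of a bounded holomorphic function along two homotopic curves\<close>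

lemma loop_winding_number_locally_constant:
  assumes "path g" "pathfinish g = pathstart g" "z \<notin> path_image g"
  obtains T where "open T" "z \<in> T" "T \<inter> path_image g = {}"
    "T \<subseteq> {w. winding_number g w = winding_number g z}"
  using open_winding_number_levelsets[OF assms(1,2), of "winding_number g z"] assms(3)
  by (intro that[of "{w. w \<notin> path_image g \<and> winding_number g w = winding_number g z}"]) auto

text \<open>A path that crosses the line \<open>Re z = \<xi>\<close> from right to left above the height \<open>-Y\<close> can be deformed,
  away from the point \<open>\<xi> - 2 \<i> Y\<close>, to a segment. Closing it through \<open>\<xi> - 3 \<i> Y\<close> then gives the
  boundary of a triangle around that point.\<close>

lemma winding_number_crossing_triangle:
  assumes p: "path p" "Im ` path_image p \<subseteq> {-Y<..}"
    and A: "\<xi> < Re (pathstart p)" and B: "Re (pathfinish p) < \<xi>" and Y: "Y > 0"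
  shows "winding_number p (Complex \<xi> (-2*Y)) +
      (winding_number (linepath (pathfinish p) (Complex \<xi> (-3*Y))) (Complex \<xi> (-2*Y)) +
      winding_number (linepath (Complex \<xi> (-3*Y)) (pathstart p)) (Complex \<xi> (-2*Y))) \<noteq> 0"
proof -
  define a b c e where "a = pathstart p" and "b = pathfinish p"
    and "c = Complex \<xi> (-3*Y)" and "e = Complex \<xi> (-2*Y)"
  have ab: "Im a > -Y" "Im b > -Y" using p by (auto simp: a_def b_def)
  \<comment> \<open>The segment from \<open>a\<close> to \<open>b\<close> meets the line at \<open>P\<close>, above \<open>e\<close>, while \<open>c\<close> lies below \<open>e\<close>.\<close>
  define s where "s = (Re a - \<xi>) / (Re a - Re b)"
  have s: "0 < s" "s < 1" using A B by (auto simp: s_def a_def b_def field_simps)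
  define P where "P = (1 - s) *\<^sub>R a + s *\<^sub>R b"
  have "Re P = Re a - s * (Re a - Re b)" by (simp add: P_def algebra_simps)
  then have ReP: "Re P = \<xi>" using A B by (simp add: s_def a_def b_def)
  have "Im P = (1 - s) * Im a + s * Im b" by (simp add: P_def)
  also have "\<dots> > (1 - s) * (-Y) + s * (-Y)"
    using s ab by (intro add_strict_mono mult_strict_left_mono) auto
  finally have ImP: "Im P > -Y" by (simp add: algebra_simps)
  define \<tau> where "\<tau> = (Im P + 2*Y) / (Im P + 3*Y)"
  have \<tau>: "0 < \<tau>" "\<tau> < 1" using ImP Y by (auto simp: \<tau>_def field_simps)
  have "\<tau> * (Im P + 3*Y) = Im P + 2*Y" using ImP Y by (simp add: \<tau>_def)
  then have e: "e = (1 - \<tau>) *\<^sub>R P + \<tau> *\<^sub>R c"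
    using ReP by (simp add: complex_eq_iff e_def c_def algebra_simps)
  have noncoll: "\<not> collinear {a, b, c}"
  proof
    assume "collinear {a, b, c}"
    then have "collinear {c, a, b}" by (simp add: insert_commute)
    then consider "a = b" | k where "c = k *\<^sub>R a + (1 - k) *\<^sub>R b"
      unfolding collinear_3_expand by (metis collinear_3_expand \<open>collinear {a, b, c}\<close> insert_commute)
    then show False
    proof cases
      case 1 then show False using A B by (simp add: a_def b_def)
    next
      case 2
      have "Re c = k * Re a + (1 - k) * Re b" "Im c = k * Im a + (1 - k) * Im b"
        by (simp_all add: 2)
      then have "k * (Re a - Re b) = \<xi> - Re b" by (simp add: c_def algebra_simps)
      then have "k = (\<xi> - Re b) / (Re a - Re b)" using A B by (simp add: a_def b_def field_simps)
      moreover have "0 < \<xi> - Re b" "\<xi> - Re b < Re a - Re b" using A B by (auto simp: a_def b_def)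
      ultimately have k: "0 < k" "k < 1" by auto
      have "k * Im a + (1 - k) * Im b > k * (-Y) + (1-k) * (-Y)"
        using k ab by (intro add_strict_mono mult_strict_left_mono) auto
      then show False using \<open>Im c = _\<close> Y by (simp add: c_def algebra_simps)
    qed
  qed
  have "e \<in> interior (convex hull {a,b,c})"
  proof -
    have "(1 - \<tau>) * (1 - s) > 0" "(1 - \<tau>) * s > 0" using s \<tau> by auto
    moreover have "(1 - \<tau>) * (1 - s) + (1 - \<tau>) * s + \<tau> = 1" by (simp add: algebra_simps)
    moreover have "((1 - \<tau>) * (1 - s)) *\<^sub>R a + ((1 - \<tau>) * s) *\<^sub>R b + \<tau> *\<^sub>R c = e"
      by (simp add: e P_def algebra_simps)
    ultimately show ?thesis
      using \<tau>(1) unfolding interior_convex_hull_3_minimal[OF noncoll DIM_complex] by blast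
  qed
  then have 1: "winding_number (linepath a b +++ linepath b c +++ linepath c a) e \<noteq> 0"
    by (subst winding_number_triangle) auto
  have half: "homotopic_paths (-{e}) p (linepath a b)"
  proof (rule homotopic_paths_subset)
    show "{z. Im z > -Y} \<subseteq> - {e}" using Y by (auto simp: e_def)
    have "simply_connected {z. Im z > -Y}"
      by (intro convex_imp_simply_connected convex_halfspace_Im_gt)
    moreover have "path_image p \<subseteq> {z. Im z > -Y}" using p by auto
    moreover have "path_image (linepath a b) \<subseteq> {z. Im z > -Y}"
      using ab by (simp add: closed_segment_subset convex_halfspace_Im_gt)
    ultimately show "homotopic_paths {z. Im z > -Y} p (linepath a b)"
      using p(1) unfolding simply_connected_eq_homotopic_paths by (simp add: a_def b_def)
  qed
  have ncl: "e \<notin> path_image (linepath a b)" "e \<notin> closed_segment b c" "e \<notin> closed_segment c a"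
  proof -
    show "e \<notin> path_image (linepath a b)" using homotopic_paths_imp_subset[OF half] by auto
    have *: "e \<notin> closed_segment x c" if x: "Re x \<noteq> \<xi>" for x
    proof
      assume "e \<in> closed_segment x c"
      then obtain u where u: "e = (1 - u) *\<^sub>R x + u *\<^sub>R c" by (auto simp: closed_segment_def)
      have "Re e = (1 - u) * Re x + u * Re c" "Im e = (1 - u) * Im x + u * Im c" by (simp_all add: u)
      then have "(1 - u) * (Re x - \<xi>) = 0" by (simp add: e_def c_def algebra_simps)
      then have "u = 1" using x by simp
      then show False using u Y by (simp add: e_def c_def complex_eq_iff)
    qed
    show "e \<notin> closed_segment b c" "e \<notin> closed_segment c a"
      using *[of a] *[of b] A B by (auto simp: a_def b_def closed_segment_commute)
  qed
  have "winding_number p e = winding_number (linepath a b) e"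
    by (rule winding_number_homotopic_paths[OF half])
  then show ?thesis using 1 ncl
    unfolding a_def[symmetric] b_def[symmetric] c_def[symmetric] e_def[symmetric]
    by (simp add: winding_number_join not_in_path_image_join)
qed

text \<open>Close both \<open>p0\<close> and the path along \<open>ea\<close>, \<open>p1\<close> and the reversed \<open>eb\<close>, which has the same
  ends, by one detour far below. The resulting loops \<open>l0\<close> and \<open>l1\<close> and the given loop \<open>l\<close> have
  winding numbers with \<open>n(l) = n(l0) - n(l1)\<close>. If no point as claimed existed, then \<open>n(l0)\<close> on \<open>U1\<close>
  and \<open>n(l1)\<close> on the rest of the line would fit together to a locally constant function,
  because \<open>n(l) = 0\<close> off the paths and outside \<open>U0 \<union> U1\<close>. But this function vanishes high up on the
  line and, by the preceding lemma, does not vanish below the two paths.\<close>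

lemma vertical_line_meets_inside_between:
  fixes p0 p1 ea eb :: "real \<Rightarrow> complex"
  assumes paths: "path p0" "path p1" "path ea" "path eb"
    and ends: "pathstart ea = pathstart p0" "pathfinish ea = pathstart p1"
      "pathstart eb = pathfinish p0" "pathfinish eb = pathfinish p1"
    and right: "\<And>z. z \<in> path_image ea \<Longrightarrow> \<xi> < Re z"
    and left: "\<And>z. z \<in> path_image eb \<Longrightarrow> Re z < \<xi>"
    and U: "open U0" "open U1" "U0 \<inter> U1 = {}"
    and p0U: "\<And>z. z \<in> path_image p0 \<Longrightarrow> Re z = \<xi> \<Longrightarrow> z \<in> U0"
    and p1U: "\<And>z. z \<in> path_image p1 \<Longrightarrow> Re z = \<xi> \<Longrightarrow> z \<in> U1"
  shows "\<exists>z. Re z = \<xi> \<and> z \<notin> U0 \<union> U1 \<and>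
     z \<notin> path_image (p0 +++ eb +++ reversepath p1 +++ reversepath ea) \<and>
     winding_number (p0 +++ eb +++ reversepath p1 +++ reversepath ea) z \<noteq> 0"
proof (rule ccontr)
  define l where "l = p0 +++ eb +++ reversepath p1 +++ reversepath ea"
  assume "\<not> ?thesis"
  then have inside: "z \<in> U0 \<union> U1" 
    if "Re z = \<xi>" "z \<notin> path_image l" "winding_number l z \<noteq> 0" for z
    using that l_def by auto
  have pl: "path l" "pathfinish l = pathstart l" "pathstart l = pathstart p0"
    using paths ends by (auto simp: l_def)
  have pil: "path_image l = path_image p0 \<union> path_image eb \<union> path_image p1 \<union> path_image ea"
    using paths ends by (simp add: l_def path_image_join Un_assoc)
  have "bounded (path_image l)" using pl by (simp add: bounded_path_image)
  then obtain Y where Y: "Y > 0" and l_bd: "\<And>z. z \<in> path_image l \<Longrightarrow> norm z < Y"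
    using bounded_pos_less by metis
  have Im_l: "- Y < Im z" "Im z < Y" if "z \<in> path_image l" for z
    using l_bd[OF that] abs_Im_le_cmod[of z] by linarith+
  define a b c where "a = pathstart p0" and "b = pathfinish p0" and "c = Complex \<xi> (-3*Y)"
  have a_in: "a \<in> path_image ea" "a \<in> path_image l"
    using ends pil pathstart_in_path_image[of ea] by (auto simp: a_def)
  have b_in: "b \<in> path_image eb" "b \<in> path_image l"
    using ends pil pathstart_in_path_image[of eb] by (auto simp: b_def)
  have ab: "\<xi> < Re a" "Re b < \<xi>" using a_in b_in left right by auto
  define k where "k = linepath b c +++ linepath c a"
  define l0 where "l0 = p0 +++ k"
  define l1 where "l1 = ea +++ p1 +++ reversepath eb +++ k"
  have k: "path k" "pathstart k = b" "pathfinish k = a" by (auto simp: k_def)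
  have l0: "path l0" "pathfinish l0 = pathstart l0" using paths k by (auto simp: l0_def a_def b_def)
  have l1: "path l1" "pathfinish l1 = pathstart l1" using paths k ends by (auto simp: l1_def a_def b_def)
  have pik: "path_image k = closed_segment b c \<union> closed_segment c a" by (simp add: k_def path_image_join)
  have pil0: "path_image l0 = path_image p0 \<union> path_image k"
    using k by (simp add: l0_def path_image_join b_def)
  have pil1: "path_image l1 = path_image ea \<union> path_image p1 \<union> path_image eb \<union> path_image k"
    using k ends by (simp add: l1_def path_image_join b_def Un_assoc)
  have k_line: "z = c" if "z \<in> path_image k" "Re z = \<xi>" for z
  proof -
    have *: "z = c" if z: "z \<in> closed_segment x c" "Re x \<noteq> \<xi>" "Re z = \<xi>" for x z
    proof -
      obtain u where u: "z = (1 - u) *\<^sub>R x + u *\<^sub>R c" using z by (auto simp: closed_segment_def)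
      have "Re z = (1 - u) * Re x + u * Re c" by (simp add: u)
      then have "(1 - u) * (Re x - \<xi>) = 0" using z by (simp add: c_def algebra_simps)
      then show ?thesis using z u by simp
    qed
    show ?thesis using that *[of z a] *[of z b] ab pik by (auto simp: closed_segment_commute)
  qed
  have diff: "winding_number l z = winding_number l0 z - winding_number l1 z"
    if "z \<notin> path_image l" "z \<notin> path_image k" for z
  proof -
    have z: "z \<notin> path_image p0" "z \<notin> path_image p1" "z \<notin> path_image ea" "z \<notin> path_image eb"
      using that pil by auto
    show ?thesis using z paths k ends that(2) unfolding l_def l0_def l1_def
      by (simp add: winding_number_join not_in_path_image_join winding_number_reversepath
          a_def[symmetric] b_def[symmetric] path_image_join)
  qed
  define S where "S = {z. Re z = \<xi> \<and> -2*Y \<le> Im z}"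
  have "S = {z. \<xi> \<le> Re z} \<inter> {z. Re z \<le> \<xi>} \<inter> {z. -2*Y \<le> Im z}" by (auto simp: S_def)
  then have "convex S"
    by (simp add: convex_Int convex_halfspace_Re_ge[of \<xi>, simplified] convex_halfspace_Re_le
        convex_halfspace_Im_ge[of "-2*Y", simplified])
  then have conn: "connected S" by (rule convex_connected)
  have k_S: "z \<notin> path_image k" if "z \<in> S" for z
  proof
    assume "z \<in> path_image k"
    then have "z = c" using that k_line[of z] by (auto simp: S_def)
    then have "Im z = -3*Y" by (simp add: c_def)
    then show False using that Y by (simp add: S_def)
  qed
  define m where "m z = (if z \<in> U1 then winding_number l0 z else winding_number l1 z)" for z
  have "m constant_on S"
  proof (rule locally_constant_imp_constant[OF conn])
    fix z assume zS: "z \<in> S"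
    then have Rez: "Re z = \<xi>" by (simp add: S_def)
    have zk: "z \<notin> path_image k" using k_S zS by blast
    have nea: "z \<notin> path_image ea" "z \<notin> path_image eb" using left right Rez by force+
    have z0: "z \<notin> path_image l0" if "z \<notin> U0" using that p0U Rez zk pil0 by auto
    have z1: "z \<notin> path_image l1" if "z \<notin> U1" using that p1U Rez zk pil1 nea by auto
    have "\<exists>T. open T \<and> z \<in> T \<and> (\<forall>w\<in>T. m w = m z)"
    proof (cases "z \<in> U1")
      case True
      then have zl0: "z \<notin> path_image l0" using z0 U by auto
      obtain T where "open T" "z \<in> T" "T \<subseteq> {w. winding_number l0 w = winding_number l0 z}"
        by (rule loop_winding_number_locally_constant[OF l0 zl0]) (use that in blast)
      then show ?thesis using True U by (intro exI[of _ "T \<inter> U1"]) (auto simp: m_def)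
    next
      case z_U1: False
      note z1 = z1[OF this]
      obtain T where T: "open T" "z \<in> T" "T \<subseteq> {w. winding_number l1 w = winding_number l1 z}"
        by (rule loop_winding_number_locally_constant[OF l1 z1]) (use that in blast)
      show ?thesis
      proof (cases "z \<in> U0")
        case True
        then show ?thesis using T U z_U1 by (intro exI[of _ "T \<inter> U0"]) (auto simp: m_def)
      next
        case False
        note z0 = z0[OF this]
          obtain T' where T': "open T'" "z \<in> T'" "T' \<subseteq> {w. winding_number l0 w = winding_number l0 z}"
          by (rule loop_winding_number_locally_constant[OF l0 z0]) (use that in blast)
        have "z \<notin> path_image l" using z0 z1 nea by (auto simp: pil pil0 pil1)
        then have "winding_number l0 z = winding_number l1 z"
          using inside[OF Rez] False z_U1 diff[OF _ zk] by fastforce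
        then show ?thesis using T T' z_U1 by (intro exI[of _ "T \<inter> T'"]) (auto simp: m_def)
      qed
    qed
    then obtain T where "open T" "z \<in> T" "\<forall>w\<in>T. m w = m z" by blast
    then show "\<exists>T. openin (top_of_set S) T \<and> z \<in> T \<and> (\<forall>w\<in>T. m w = m z)"
      using zS by (intro exI[of _ "S \<inter> T"] conjI openin_open_Int) blast+
  qed
  define t where "t = Complex \<xi> Y"
  define e where "e = Complex \<xi> (-2*Y)"
  have tS: "t \<in> S" and eS: "e \<in> S" using Y by (auto simp: t_def e_def S_def)
  have Im_k: "Im z < Y" if "z \<in> path_image k" for z
  proof -
    have "closed_segment b c \<union> closed_segment c a \<subseteq> {z. Im z < Y}"
      using Im_l[OF a_in(2)] Im_l[OF b_in(2)] Y
      by (intro Un_least closed_segment_subset convex_halfspace_Im_lt) (auto simp: c_def)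
    then show ?thesis using that pik by blast
  qed
  have "winding_number l0 t = 0"
    by (rule winding_number_zero_outside[OF l0(1) convex_halfspace_Im_lt[of Y] l0(2)])
       (use Im_k Im_l in \<open>auto simp: t_def pil0 pil\<close>)
  moreover have "winding_number l1 t = 0"
    by (rule winding_number_zero_outside[OF l1(1) convex_halfspace_Im_lt[of Y] l1(2)])
       (use Im_k Im_l in \<open>auto simp: t_def pil1 pil\<close>)
  ultimately have "m t = 0" by (simp add: m_def)
  moreover have "m t = m e" using \<open>m constant_on S\<close> tS eS by (metis constant_on_def)
  moreover have "m e \<noteq> 0"
  proof -
    have e_l: "e \<notin> path_image l" using Im_l[of e] Y by (auto simp: e_def)
    have "winding_number l e = 0"
      by (rule winding_number_zero_outside[OF pl(1) convex_halfspace_Im_gt[of "-Y"] pl(2)])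
         (use Im_l Y in \<open>auto simp: e_def pil\<close>)
    then have "winding_number l0 e = winding_number l1 e" using diff[OF e_l k_S[OF eS]] by simp
    moreover have "winding_number l0 e \<noteq> 0"
    proof -
      have "e \<notin> path_image p0" "e \<notin> closed_segment b c" "e \<notin> closed_segment c a"
        using e_l k_S[OF eS] by (auto simp: pil pik)
      moreover have Im_p0: "Im ` path_image p0 \<subseteq> {-Y<..}" using Im_l pil by auto
      have "winding_number p0 e + (winding_number (linepath b c) e + winding_number (linepath c a) e) \<noteq> 0"
        using winding_number_crossing_triangle[OF paths(1) Im_p0, of \<xi>] ab Y
        unfolding a_def b_def c_def e_def by simp
      ultimately show ?thesis using paths k unfolding l0_def k_def
        by (simp add: winding_number_join not_in_path_image_join path_image_join b_def)
    qed
    ultimately show ?thesis by (simp add: m_def)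
  qed
  ultimately show False by simp
qed

lemma winding_number_rectangle_image_eq_0:
  fixes L :: "complex \<Rightarrow> complex" and a b c d :: complex
  assumes L: "continuous_on S L" and S: "convex S" "{a,b,c,d} \<subseteq> S" and z: "z \<notin> L ` S"
  shows "winding_number (L \<circ> (linepath a b +++ linepath b c +++ linepath c d +++ linepath d a)) z = 0"
proof -
  define r where "r = linepath a b +++ linepath b c +++ linepath c d +++ linepath d a"
  have "path_image r \<subseteq> S" unfolding r_def
    using S by (auto simp: path_image_join intro!: closed_segment_subset dest: subsetD[OF closed_segment_subset, rotated])
  moreover have "path r" "pathfinish r = pathstart r" by (auto simp: r_def)
  ultimately have "homotopic_loops S r (linepath a a)"
    using convex_imp_simply_connected[OF S(1)] S(2)
    unfolding simply_connected_eq_contractible_loop_any by blast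
  then have "homotopic_loops (-{z}) (L \<circ> r) (L \<circ> linepath a a)"
    by (rule homotopic_loops_continuous_image[OF _ L]) (use z in auto)
  moreover have "L \<circ> linepath a a = linepath (L a) (L a)" by (auto simp: linepath_def fun_eq_iff)
  moreover have "winding_number (linepath (L a) (L a)) z = 0"
    using z S by (intro winding_number_trivial) auto
  ultimately show ?thesis unfolding r_def by (metis winding_number_homotopic_loops)
qed

text \<open>The case of a homotopy \<open>L\<close> that goes to \<open>-\<infinity>\<close> in real part. The bounded function
  \<open>G = (F - q0) (F - q1)\<close> is less than \<open>\<epsilon>\<close> on the images of the horizontal sides of a
  rectangle far to the right in the parameter strip, and at most \<open>C\<close> on those of the vertical sides. Multiplication with \<open>exp (- a h)\<close>, where
  \<open>a = ln (C / \<epsilon>)\<close> and \<open>Re h \<ge> 1\<close> on the images of the vertical sides, makes it at most \<open>\<epsilon>\<close> on the whole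
  boundary. The real part of \<open>h\<close> is at most \<open>1/2\<close> on the line \<open>Re z = \<xi>\<close>, and this gives
  \<open>\<bar>G\<bar> \<le> sqrt (\<epsilon> C)\<close> there.\<close>

lemma lindelof_two_limits_half_plane:
  fixes L F :: "complex \<Rightarrow> complex"
  defines "S \<equiv> {z. 0 \<le> Re z \<and> 0 \<le> Im z \<and> Im z \<le> 1}"
  assumes contL: "continuous_on S L" and V: "open V" "L ` S \<subseteq> V"
    and F: "F holomorphic_on V" "\<And>z. z \<in> V \<Longrightarrow> norm (F z) \<le> M"
    and Linf: "\<And>K. \<exists>T. \<forall>z\<in>S. T \<le> Re z \<longrightarrow> Re (L z) \<le> K"
    and q0: "((\<lambda>t. F (L (Complex t 0))) \<longlongrightarrow> q0) at_top"
    and q1: "((\<lambda>t. F (L (Complex t 1))) \<longlongrightarrow> q1) at_top"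
  shows "q0 = q1"
proof (rule ccontr)
  assume "q0 \<noteq> q1"
  define d where "d = norm (q0 - q1)"
  have d: "d > 0" using \<open>q0 \<noteq> q1\<close> by (simp add: d_def)
  define G where "G z = (F z - q0) * (F z - q1)" for z
  define C where "C = (\<bar>M\<bar> + norm q0) * (\<bar>M\<bar> + norm q1) + 1"
  have C: "C \<ge> 1" by (simp add: C_def)
  have G_le: "norm (G z) \<le> C" if "z \<in> V" for z
  proof -
    have "norm (F z) \<le> \<bar>M\<bar>" using F(2)[OF that] by simp
    then have "norm (F z - q0) \<le> \<bar>M\<bar> + norm q0" "norm (F z - q1) \<le> \<bar>M\<bar> + norm q1"
      by (smt (verit) norm_triangle_ineq4)+
    then have "norm (G z) \<le> (\<bar>M\<bar> + norm q0) * (\<bar>M\<bar> + norm q1)"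
      unfolding G_def norm_mult by (intro mult_mono) auto
    then show ?thesis by (simp add: C_def)
  qed
  \<comment> \<open>If \<open>\<bar>G z\<bar> < d\<^sup>2 / 4\<close>, then \<open>F z\<close> is closer than \<open>d / 2\<close> to \<open>q0\<close> or to \<open>q1\<close>. The bound \<open>sqrt (\<epsilon> * C) \<le> d\<^sup>2 / 8\<close> ensures this.\<close>
  define \<epsilon> where "\<epsilon> = min (d^4 / (64 * C)) (1/2)"
  have \<epsilon>: "0 < \<epsilon>" "\<epsilon> < C" "\<epsilon> * C \<le> d^4 / 64"
  proof -
    show "0 < \<epsilon>" using d C by (simp add: \<epsilon>_def)
    have "\<epsilon> \<le> 1/2" "\<epsilon> \<le> d^4 / (64 * C)" by (simp_all add: \<epsilon>_def)
    then show "\<epsilon> < C" "\<epsilon> * C \<le> d^4 / 64" using C by (simp_all add: field_simps)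
  qed
  define a where "a = ln (C / \<epsilon>)"
  have a: "a > 0" "exp a = C / \<epsilon>" using \<epsilon> C by (auto simp: a_def)
  have exp_half: "\<epsilon> * exp (a / 2) < d\<^sup>2 / 4"
  proof (rule power2_less_imp_less)
    have "exp (a / 2) ^ 2 = exp a" by (simp flip: exp_of_nat_mult)
    then have "(\<epsilon> * exp (a / 2))\<^sup>2 = \<epsilon>\<^sup>2 * (C / \<epsilon>)" using a by (simp add: power_mult_distrib)
    also have "\<dots> = \<epsilon> * C" using \<epsilon> by (simp add: power2_eq_square)
    also have "\<dots> \<le> d^4 / 64" by (rule \<epsilon>(3))
    also have "\<dots> < d^4 / 16" using d by (intro divide_strict_left_mono) auto
    also have "\<dots> = (d\<^sup>2 / 4)\<^sup>2" by (simp add: power_divide)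
    finally show "(\<epsilon> * exp (a / 2))\<^sup>2 < (d\<^sup>2 / 4)\<^sup>2" .
  qed simp

  have "\<forall>\<^sub>F t in at_top. norm (F (L (Complex t 0)) - q0) < d/2"
    "\<forall>\<^sub>F t in at_top. norm (F (L (Complex t 1)) - q1) < d/2"
    using tendstoD[OF q0, of "d/2"] tendstoD[OF q1, of "d/2"] d by (simp_all add: dist_norm)
  moreover have "((\<lambda>t. G (L (Complex t 0))) \<longlongrightarrow> (q0 - q0) * (q0 - q1)) at_top"
    "((\<lambda>t. G (L (Complex t 1))) \<longlongrightarrow> (q1 - q0) * (q1 - q1)) at_top"
    unfolding G_def by (intro tendsto_intros q0 q1)+
  then have "\<forall>\<^sub>F t in at_top. norm (G (L (Complex t 0))) < \<epsilon>"
    "\<forall>\<^sub>F t in at_top. norm (G (L (Complex t 1))) < \<epsilon>"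
    using \<epsilon>(1) by (simp_all add: tendsto_iff)
  ultimately have "\<forall>\<^sub>F t in at_top. norm (F (L (Complex t 0)) - q0) < d/2 \<and>
      norm (F (L (Complex t 1)) - q1) < d/2 \<and>
      norm (G (L (Complex t 0))) < \<epsilon> \<and> norm (G (L (Complex t 1))) < \<epsilon>"
    by eventually_elim auto
  then obtain R0 where R0: "\<And>t. t \<ge> R0 \<Longrightarrow> norm (F (L (Complex t 0)) - q0) < d/2 \<and>
      norm (F (L (Complex t 1)) - q1) < d/2 \<and>
      norm (G (L (Complex t 0))) < \<epsilon> \<and> norm (G (L (Complex t 1))) < \<epsilon>"
    unfolding eventually_at_top_linorder by blast
  obtain R1 where R1: "\<And>z. z \<in> S \<Longrightarrow> R1 \<le> Re z \<Longrightarrow> Re (L z) \<le> -1" using Linf by blast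
  define R where "R = Max {R0, R1, 0}"
  have R: "R \<ge> R0" "R \<ge> R1" "R \<ge> 0" by (auto simp: R_def)

  define E where "E = L ` closed_segment (Complex R 0) (Complex R 1)"
  have segE: "closed_segment (Complex R 0) (Complex R 1) \<subseteq> S"
    using R by (auto simp: S_def closed_segment_def)
  have "compact E" unfolding E_def
    by (intro compact_continuous_image continuous_on_subset[OF contL segE] compact_segment)
  have EL: "Re z \<le> -1" if "z \<in> E" for z
  proof -
    from that obtain w where "w \<in> closed_segment (Complex R 0) (Complex R 1)" "z = L w" 
      by (auto simp: E_def)
    moreover from this have "Re w = R" by (auto simp: closed_segment_def) (simp add: algebra_simps)
    ultimately show ?thesis using R1[of w] R segE by auto
  qed
  obtain B where B: "B > 0" "\<And>z. z \<in> E \<Longrightarrow> norm z \<le> B" 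
    using compact_imp_bounded[OF \<open>compact E\<close>] bounded_pos by metis
  \<comment> \<open>The positive harmonic function \<open>Re (- 1 / z)\<close> tends to \<open>0\<close> at infinity but is at least \<open>c\<close> on the image \<open>E\<close> of the left side of the rectangle.\<close>
  define c where "c = 1 / B\<^sup>2"
  have c: "c > 0" using B by (simp add: c_def)
  have uE: "c \<le> Re (- 1 / z)" if "z \<in> E" for z
  proof -
    have z: "z \<noteq> 0" "Re z \<le> -1" "norm z \<le> B" using EL[OF that] B(2)[OF that] by auto
    have "Re (-1 / z) = - Re z / (norm z)\<^sup>2" using z by (simp add: Re_divide cmod_power2)
    also have "\<dots> \<ge> 1 / B\<^sup>2" using z B by (intro frac_le power_mono) auto
    finally show ?thesis by (simp add: c_def)
  qed
  \<comment> \<open>Far enough to the left for \<open>Re (- 1 / z) / c \<le> 1 / 4\<close> to hold on the line, and for the line to miss \<open>E\<close>.\<close>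
  define \<xi> where "\<xi> = - (B + 1 + 4 / c)"
  have \<xi>: "\<xi> < - B" "\<xi> \<le> - 4 / c" "\<xi> < 0"
    using B(1) divide_pos_pos[of 4 c] c unfolding \<xi>_def by linarith+
  \<comment> \<open>The right side is mapped so far to the left that \<open>Re z / (4 * \<xi>)\<close> is at least \<open>1\<close> there; it is \<open>1 / 4\<close> on the line.\<close>
  obtain T0 where T0: "\<And>z. z \<in> S \<Longrightarrow> T0 \<le> Re z \<Longrightarrow> Re (L z) \<le> 4 * \<xi>" using Linf by blast
  define T where "T = max (R + 1) T0"
  have T: "T > R" "T \<ge> T0" by (auto simp: T_def)

  define p0 where "p0 = L \<circ> linepath (Complex R 0) (Complex T 0)"
  define p1 where "p1 = L \<circ> linepath (Complex R 1) (Complex T 1)"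
  define ea where "ea = L \<circ> linepath (Complex R 0) (Complex R 1)"
  define eb where "eb = L \<circ> linepath (Complex T 0) (Complex T 1)"
  define D where "D = {z. R \<le> Re z} \<inter> {z. Re z \<le> T} \<inter> {z. 0 \<le> Im z} \<inter> {z. Im z \<le> 1}"
  have D: "convex D" unfolding D_def
    by (intro convex_Int convex_halfspace_Re_le convex_halfspace_Im_le
         convex_halfspace_Re_ge[of R, simplified] convex_halfspace_Im_ge)
  have DS: "D \<subseteq> S" using R by (auto simp: D_def S_def)
  have corners: "Complex R 0 \<in> D" "Complex R 1 \<in> D" "Complex T 0 \<in> D" "Complex T 1 \<in> D"
    using T by (auto simp: D_def)
  have segD: "closed_segment x y \<subseteq> D" if "x \<in> D" "y \<in> D" for x y
    using that D by (simp add: closed_segment_subset)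
  have pathL: "path (L \<circ> linepath x y)" if "x \<in> D" "y \<in> D" for x y
    using segD[OF that] DS
    by (intro path_continuous_image continuous_on_subset[OF contL]) auto
  have paths: "path p0" "path p1" "path ea" "path eb"
    unfolding p0_def p1_def ea_def eb_def by (intro pathL corners)+
  have ends: "pathstart ea = pathstart p0" "pathfinish ea = pathstart p1"
      "pathstart eb = pathfinish p0" "pathfinish eb = pathfinish p1"
    by (simp_all add: p0_def p1_def ea_def eb_def pathstart_compose pathfinish_compose)
  define l where "l = p0 +++ eb +++ reversepath p1 +++ reversepath ea"
  have pl: "path l" "pathfinish l = pathstart l" using paths ends by (auto simp: l_def)
  have pil: "path_image l = path_image p0 \<union> path_image eb \<union> path_image p1 \<union> path_image ea"
    using paths ends by (simp add: l_def path_image_join Un_assoc)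
  have l_eq: "l = L \<circ> (linepath (Complex R 0) (Complex T 0) +++ linepath (Complex T 0) (Complex T 1) +++
     linepath (Complex T 1) (Complex R 1) +++ linepath (Complex R 1) (Complex R 0))"
    by (simp add: l_def p0_def p1_def ea_def eb_def path_compose_join flip: path_compose_reversepath)
  have pi_D: "path_image l \<subseteq> L ` D"
    using segD corners unfolding pil p0_def p1_def ea_def eb_def path_image_compose path_image_linepath
    by (intro Un_least image_mono) auto
  \<comment> \<open>The inside of the loop. It is covered by the image of the rectangle, hence by the domain of \<open>F\<close>.\<close>
  define O' where "O' = {z. z \<notin> path_image l \<and> winding_number l z \<noteq> 0}"
  have O_D: "O' \<subseteq> L ` D"
    using winding_number_rectangle_image_eq_0[OF continuous_on_subset[OF contL DS] D]
      corners unfolding O'_def l_eq by blast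
  have openO: "open O'"
  proof -
    have "O' = (\<Union>k\<in>-{0}. {z. z \<notin> path_image l \<and> winding_number l z = k})" by (auto simp: O'_def)
    then show ?thesis using open_winding_number_levelsets[OF pl] by auto
  qed
  have "compact (L ` D)"
  proof (rule compact_continuous_image[OF continuous_on_subset[OF contL DS]])
    have "D = cbox (Complex R 0) (Complex T 1)" by (auto simp: D_def in_cbox_complex_iff)
    then show "compact D" by simp
  qed
  then have clO: "closure O' \<subseteq> L ` D" and bdO: "bounded O'"
    using O_D closure_minimal[OF O_D] compact_imp_closed compact_imp_bounded bounded_subset
    by blast+
  have frO: "frontier O' \<subseteq> path_image l"
  proof
    fix z assume z: "z \<in> frontier O'"
    show "z \<in> path_image l"
    proof (rule ccontr)
      assume nz: "z \<notin> path_image l"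
      have "z \<notin> O'" using z openO by (simp add: frontier_def interior_open)
      then have wz: "winding_number l z = 0" using nz by (auto simp: O'_def)
      obtain A where A: "open A" "z \<in> A" "A \<subseteq> {w. winding_number l w = winding_number l z}"
        by (rule loop_winding_number_locally_constant[OF pl nz]) (use that in blast)
      then have "A \<inter> O' = {}" using wz by (auto simp: O'_def)
      then have "A \<inter> closure O' = {}" using A(1) by (simp add: open_Int_closure_eq_empty)
      then show False using A z by (auto simp: frontier_def)
    qed
  qed
  have LD: "z \<in> V \<and> Re z \<le> -1" if "z \<in> L ` D" for z
    using that DS V R1 R by (auto simp: D_def)

  define h where "h z = - 1 / (c * z) + z / (4 * \<xi>)" for z :: complex
  define K where "K z = G z * exp (- a * h z)" for z
  have Re_h: "Re (h z) = Re (- 1 / z) / c + Re z / (4 * \<xi>)" for z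
  proof -
    have "Re (- 1 / (c * z)) = Re ((- 1 / z) / c)" by (simp add: field_simps)
    also have "\<dots> = Re (- 1 / z) / c" by (rule Re_divide_of_real)
    finally have "Re (- 1 / (c * z)) = Re (- 1 / z) / c" .
    moreover have "Re (z / (4 * \<xi>)) = Re z / (4 * \<xi>)" 
      using Re_divide_of_real[of z "4 * \<xi>"] by simp
    ultimately show ?thesis by (simp add: h_def)
  qed
  have inv_pos: "Re (- 1 / z) \<ge> 0" if "Re z \<le> -1" for z
    using that by (simp add: Re_divide divide_nonpos_nonneg)
  have norm_K: "norm (K z) = norm (G z) * exp (- a * Re (h z))" for z
    by (simp add: K_def norm_mult)
  have edge: "norm (K z) \<le> \<epsilon>" if "z \<in> V" "Re (h z) \<ge> 1" for z
  proof -
    have "norm (K z) \<le> C * exp (- a)"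
      unfolding norm_K using that a C by (intro mult_mono G_le) auto
    also have "\<dots> = \<epsilon>" using a \<epsilon> C by (simp add: exp_minus field_simps)
    finally show ?thesis .
  qed
  have side: "norm (K z) \<le> \<epsilon>" if "norm (G z) < \<epsilon>" "Re z \<le> -1" for z
  proof -
    have "Re (h z) \<ge> 0" unfolding Re_h using that inv_pos[OF that(2)] \<xi> c
      by (intro add_nonneg_nonneg divide_nonneg_pos divide_nonpos_neg) auto
    then have "norm (K z) \<le> \<epsilon> * 1"
      unfolding norm_K using that a \<epsilon>(1) by (intro mult_mono) (auto simp: less_imp_le)
    then show ?thesis by simp
  qed
  have seg_h: "linepath (Complex R s) (Complex T s) ` {0..1} \<subseteq> (\<lambda>t. Complex t s) ` {R..T}" for s
  proof -
    have "linepath (Complex R s) (Complex T s) u = Complex ((1-u) * R + u * T) s" for u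
      by (simp add: linepath_def complex_eq_iff algebra_simps)
    moreover have "(1-u) * R + u * T \<in> {R..T}" if "u \<in> {0..1}" for u
      using convex_bound_le[of R T T "1-u" u] convex_bound_le[of "-R" "-R" "-T" "1-u" u] that T
      by auto
    ultimately show ?thesis by auto
  qed
  have p0_t: "\<exists>t\<ge>R. z = L (Complex t 0)" if "z \<in> path_image p0" for z
    using that seg_h[of 0] by (force simp: p0_def path_image_def)
  have p1_t: "\<exists>t\<ge>R. z = L (Complex t 1)" if "z \<in> path_image p1" for z
    using that seg_h[of 1] by (force simp: p1_def path_image_def)
  have ea_E: "path_image ea = E" by (simp add: ea_def E_def path_image_compose)
  have eb_T: "Re z \<le> 4 * \<xi>" if z: "z \<in> path_image eb" for z
  proof -
    obtain w where w: "w \<in> closed_segment (Complex T 0) (Complex T 1)" "z = L w"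
      using z by (auto simp: eb_def path_image_compose)
    then have "Re w = T" by (auto simp: closed_segment_def) (simp add: algebra_simps)
    then show ?thesis using w T0[of w] T segD[OF corners(3,4)] DS by auto
  qed
  have K_bd: "norm (K z) \<le> \<epsilon>" if z: "z \<in> path_image l" for z
  proof -
    have zV: "z \<in> V" "Re z \<le> -1" using LD pi_D z by auto
    consider "z \<in> path_image p0" | "z \<in> path_image p1" | "z \<in> E" | "z \<in> path_image eb"
      using z unfolding pil ea_E by blast
    then show ?thesis
    proof cases
      case 1 then show ?thesis using p0_t[OF 1] R0 R zV by (intro side) force+
    next
      case 2 then show ?thesis using p1_t[OF 2] R0 R zV by (intro side) force+
    next
      case 3
      have "1 \<le> Re (- 1 / z) / c" using uE[OF 3] c by (metis le_divide_eq_1_pos)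
      moreover have "0 \<le> Re z / (4 * \<xi>)" using zV \<xi> by (intro divide_nonpos_neg) auto
      ultimately show ?thesis using zV by (intro edge) (simp_all add: Re_h)
    next
      case 4
      have "1 \<le> Re z / (4 * \<xi>)" using eb_T[OF 4] \<xi> by (simp add: le_divide_eq)
      moreover have "0 \<le> Re (- 1 / z) / c" using inv_pos[OF zV(2)] c by (metis divide_nonneg_pos)
      ultimately show ?thesis using zV by (intro edge) (simp_all add: Re_h)
    qed
  qed
  have K_hol: "K holomorphic_on V \<inter> {z. z \<noteq> 0}" unfolding K_def G_def h_def
    by (intro holomorphic_intros holomorphic_on_subset[OF F(1)]) (use c \<xi> in auto)
  have clO_V: "closure O' \<subseteq> V \<inter> {z. z \<noteq> 0}" using clO LD by fastforce
  have K_O: "norm (K z) \<le> \<epsilon>" if "z \<in> O'" for z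
  proof (rule maximum_modulus_frontier[OF _ _ bdO _ that])
    show "K holomorphic_on interior O'"
      by (rule holomorphic_on_subset[OF K_hol])
         (use clO_V interior_subset[of O'] closure_subset[of O'] in blast)
    show "continuous_on (closure O') K"
      by (rule continuous_on_subset[OF holomorphic_on_imp_continuous_on[OF K_hol] clO_V])
    show "norm (K w) \<le> \<epsilon>" if "w \<in> frontier O'" for w using that frO K_bd by blast
  qed
  define U0 where "U0 = {z \<in> V. norm (F z - q0) < d / 2}"
  define U1 where "U1 = {z \<in> V. norm (F z - q1) < d / 2}"
  have openU: "open U0" "open U1"
  proof -
    have "continuous_on V (\<lambda>z. norm (F z - q))" for q
      by (intro continuous_intros holomorphic_on_imp_continuous_on F)
    then have "open (V \<inter> (\<lambda>z. norm (F z - q)) -` {..<d/2})" for q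
      using V by (intro continuous_open_preimage) auto
    moreover have "U0 = V \<inter> (\<lambda>z. norm (F z - q0)) -` {..<d/2}" "U1 = V \<inter> (\<lambda>z. norm (F z - q1)) -` {..<d/2}"
      by (auto simp: U0_def U1_def)
    ultimately show "open U0" "open U1" by auto
  qed
  have disj: "U0 \<inter> U1 = {}"
  proof -
    have False if "norm (F z - q0) < d/2" "norm (F z - q1) < d/2" for z
      using that norm_triangle_ineq4[of "F z - q1" "F z - q0"] by (simp add: d_def)
    then show ?thesis by (auto simp: U0_def U1_def)
  qed
  obtain z where z: "Re z = \<xi>" "z \<notin> U0 \<union> U1" "z \<in> O'"
  proof -
    have "\<xi> < Re z" if "z \<in> path_image ea" for z
      using B(2)[of z] that abs_Re_le_cmod[of z] \<xi>(1) by (auto simp: ea_E)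
    moreover have "Re z < \<xi>" if "z \<in> path_image eb" for z
      using eb_T[OF that] \<xi> by simp
    moreover have "z \<in> U0" if z: "z \<in> path_image p0" for z
    proof -
      obtain t where "t \<ge> R" "z = L (Complex t 0)" using p0_t[OF z] by blast
      moreover have "z \<in> V" using LD pi_D z by (auto simp: pil)
      ultimately show ?thesis using R0[of t] R by (simp add: U0_def)
    qed
    moreover have "z \<in> U1" if z: "z \<in> path_image p1" for z
    proof -
      obtain t where "t \<ge> R" "z = L (Complex t 1)" using p1_t[OF z] by blast
      moreover have "z \<in> V" using LD pi_D z by (auto simp: pil)
      ultimately show ?thesis using R0[of t] R by (simp add: U1_def)
    qed
    ultimately have "\<exists>z. Re z = \<xi> \<and> z \<notin> U0 \<union> U1 \<and> z \<notin> path_image l \<and> winding_number l z \<noteq> 0"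
      unfolding l_def by (intro vertical_line_meets_inside_between paths ends openU disj)
    then show thesis using that unfolding O'_def by blast
  qed
  have zV: "z \<in> V" using z O_D LD by blast
  have "Re (- 1 / z) / c \<le> 1 / 4"
  proof -
    have "z \<noteq> 0" using z(1) \<xi> by auto
    have "Re (- 1 / z) \<le> norm (- 1 / z)" by (rule complex_Re_le_cmod)
    also have "\<dots> = 1 / norm z" by (simp add: norm_divide)
    also have "\<dots> \<le> 1 / \<bar>\<xi>\<bar>" using abs_Re_le_cmod[of z] z(1) \<xi> by (intro frac_le) auto
    also have "\<dots> \<le> c / 4" using \<xi> c by (simp add: field_simps)
    finally show ?thesis using c by (simp add: field_simps)
  qed
  moreover have "Re z / (4 * \<xi>) = 1 / 4" using z(1) \<xi> by simp
  ultimately have hz: "Re (h z) \<le> 1 / 2" unfolding Re_h by linarith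
  have "norm (G z) = norm (K z) * exp (a * Re (h z))" by (simp add: norm_K exp_minus)
  also have "\<dots> \<le> \<epsilon> * exp (a / 2)" using K_O[OF z(3)] hz a \<epsilon> by (intro mult_mono) auto
  also have "\<dots> < d\<^sup>2 / 4" by (rule exp_half)
  finally have "norm (G z) < d\<^sup>2 / 4" .
  moreover have "(d / 2) * (d / 2) \<le> norm (F z - q0) * norm (F z - q1)"
    using z(2) zV d by (intro mult_mono) (auto simp: U0_def U1_def)
  ultimately show False by (simp add: G_def norm_mult power2_eq_square)
qed

text \<open>The strip is contractible, so the homotopy \<open>H\<close>, which avoids its limit \<open>0\<close>, has a continuous
  logarithm. Its real part tends to \<open>-\<infinity>\<close>, uniformly across the strip.\<close>

lemma lindelof_two_limits_homotopic:
  fixes H F :: "complex \<Rightarrow> complex"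
  defines "S \<equiv> {z. 0 \<le> Re z \<and> 0 \<le> Im z \<and> Im z \<le> 1}"
  assumes contH: "continuous_on S H" and V: "open V" "H ` S \<subseteq> V" "0 \<notin> V"
    and F: "F holomorphic_on V" "\<And>z. z \<in> V \<Longrightarrow> norm (F z) \<le> M"
    and H0: "\<And>\<epsilon>. \<epsilon> > 0 \<Longrightarrow> \<exists>T. \<forall>z\<in>S. T \<le> Re z \<longrightarrow> norm (H z) < \<epsilon>"
    and q0: "((\<lambda>t. F (H (Complex t 0))) \<longlongrightarrow> q0) at_top"
    and q1: "((\<lambda>t. F (H (Complex t 1))) \<longlongrightarrow> q1) at_top"
  shows "q0 = q1"
proof -
  have "S = {z. 0 \<le> Re z} \<inter> {z. 0 \<le> Im z} \<inter> {z. Im z \<le> 1}" by (auto simp: S_def)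
  then have "convex S"
    by (simp add: convex_Int convex_halfspace_Re_ge[of 0] convex_halfspace_Im_ge[of 0] convex_halfspace_Im_le)
  then have "contractible S" by (rule convex_imp_contractible)
  moreover have "H z \<noteq> 0" if "z \<in> S" for z using that V by auto
  ultimately obtain L where L: "continuous_on S L" "\<And>z. z \<in> S \<Longrightarrow> H z = exp (L z)"
    using continuous_logarithm_on_contractible[OF contH] by metis
  have evS: "\<forall>\<^sub>F t in at_top. Complex t s \<in> S" if "s \<in> {0,1}" for s
    using eventually_ge_at_top[of 0] by eventually_elim (use that in \<open>auto simp: S_def\<close>)
  have F_lim: "((\<lambda>t. (F \<circ> exp) (L (Complex t s))) \<longlongrightarrow> q) at_top"
    if "((\<lambda>t. F (H (Complex t s))) \<longlongrightarrow> q) at_top" "s \<in> {0,1}" for s q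
    by (rule Lim_transform_eventually[OF that(1)], rule eventually_mono[OF evS[OF that(2)]])
       (simp add: L)
  show ?thesis
  proof (rule lindelof_two_limits_half_plane[of L "exp -` V" "F \<circ> exp" M q0 q1, folded S_def])
    show "open (exp -` V)" by (intro open_vimage V continuous_intros)
    show "F \<circ> exp holomorphic_on exp -` V"
      by (intro holomorphic_on_compose_gen[OF _ F(1)] holomorphic_intros) auto
    show "L ` S \<subseteq> exp -` V" using V L by auto
    show "norm ((F \<circ> exp) z) \<le> M" if "z \<in> exp -` V" for z using that F by auto
    show "\<exists>T. \<forall>z\<in>S. T \<le> Re z \<longrightarrow> Re (L z) \<le> K" for K
    proof -
      obtain T where T: "\<forall>z\<in>S. T \<le> Re z \<longrightarrow> norm (H z) < exp K" using H0[of "exp K"] by auto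
      have "Re (L z) \<le> K" if "z \<in> S" "T \<le> Re z" for z
      proof -
        have "exp (Re (L z)) < exp K" using T that L by (metis norm_exp_eq_Re)
        then show ?thesis by simp
      qed
      then show ?thesis by blast
    qed
  qed (use L F_lim q0 q1 in auto)
qed

section \<open>Topology and charts of the Riemann sphere\<close>

declare topspace_Alexandroff_compactification [simp del] topspace_P1 [simp]

lemma Hausdorff_space_P1: "Hausdorff_space P1"
  by (simp add: Hausdorff_space_Alexandroff_compactification locally_compact_space_euclidean)

lemma openin_P1_iff:
  "openin P1 G \<longleftrightarrow> open (Some -` G) \<and> (None \<in> G \<longrightarrow> (\<exists>B. \<forall>w. B < norm w \<longrightarrow> Some w \<in> G))"
proof
  assume "openin P1 G"
  then consider U where "open U" "G = Some ` U"
    | C where "compact C" "G = insert None (Some ` (- C))"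
    unfolding openin_Alexandroff_compactification by (auto simp: Compl_eq_Diff_UNIV)
  then show "open (Some -` G) \<and> (None \<in> G \<longrightarrow> (\<exists>B. \<forall>w. B < norm w \<longrightarrow> Some w \<in> G))"
  proof cases
    case 1
    then have "Some -` G = U" "None \<notin> G" by auto
    then show ?thesis using 1 by simp
  next
    case 2
    then have "Some -` G = - C" by auto
    moreover obtain B where "\<And>w. w \<in> C \<Longrightarrow> norm w \<le> B"
      using compact_imp_bounded[OF 2(1)] by (auto simp: bounded_iff)
    moreover have "Some w \<in> G" if "B < norm w" for w
      using that 2 calculation(2)[of w] by auto
    ultimately show ?thesis using 2(1) by (auto simp: open_Compl compact_imp_closed)
  qed
next
  assume R: "open (Some -` G) \<and> (None \<in> G \<longrightarrow> (\<exists>B. \<forall>w. B < norm w \<longrightarrow> Some w \<in> G))"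
  show "openin P1 G"
  proof (cases "None \<in> G")
    case True
    define C where "C = - (Some -` G)"
    obtain B where "\<And>w. B < norm w \<Longrightarrow> Some w \<in> G" using R True by auto
    then have "norm w \<le> B" if "w \<in> C" for w using that by (auto simp: C_def not_less[symmetric])
    then have "bounded C" unfolding bounded_iff by blast
    then have "compact C" using R by (simp add: C_def compact_eq_bounded_closed closed_Compl)
    moreover have "G = insert None (Some ` (- C))"
    proof (intro set_eqI)
      show "x \<in> G \<longleftrightarrow> x \<in> insert None (Some ` (- C))" for x
        using True by (cases x) (auto simp: C_def)
    qed
    ultimately show ?thesis
      unfolding openin_Alexandroff_compactification by (auto simp: Compl_eq_Diff_UNIV compact_imp_closed)
  next
    case False
    then have "G = Some ` (Some -` G)"
      by (intro set_eqI) (metis image_vimage_eq Int_iff UNIV_I image_eqI not_None_eq rangeI)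
    then show ?thesis using R unfolding openin_Alexandroff_compactification by auto
  qed
qed

text \<open>The coordinate change \<open>1/z\<close>. Composing with it exchanges \<open>0\<close> and \<open>\<infinity>\<close>, so that statements about the point
  at infinity reduce to statements about finite points.\<close>

definition P1_inv :: "complex option \<Rightarrow> complex option" where
  "P1_inv z = (case z of None \<Rightarrow> Some 0 | Some w \<Rightarrow> if w = 0 then None else Some (inverse w))"

lemma P1_inv_simps [simp]: "P1_inv None = Some 0" "P1_inv (Some 0) = None"
    "w \<noteq> 0 \<Longrightarrow> P1_inv (Some w) = Some (inverse w)" "P1_inv (P1_inv z) = z"
  by (auto simp: P1_inv_def split: option.splits)

lemma P1_inv_eq_iff: "P1_inv z = w \<longleftrightarrow> z = P1_inv w"
  by (metis P1_inv_simps(4))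

lemma P1_inv_eq_special_iff [simp]: "P1_inv z = None \<longleftrightarrow> z = Some 0" "P1_inv z = Some 0 \<longleftrightarrow> z = None"
  by (auto simp: P1_inv_eq_iff)

lemma continuous_map_P1_inv: "continuous_map P1 P1 P1_inv"
proof -
  have "openin P1 (P1_inv -` G)" if G: "openin P1 G" for G
  proof -
    have G': "open (Some -` G)" using G by (simp add: openin_P1_iff)
    have "open (Some -` (P1_inv -` G))"
    proof (subst open_subopen, intro ballI)
      fix w assume w: "w \<in> Some -` (P1_inv -` G)"
      show "\<exists>T. open T \<and> w \<in> T \<and> T \<subseteq> Some -` (P1_inv -` G)"
      proof (cases "w = 0")
        case True
        then obtain B where B: "\<And>x. B < norm x \<Longrightarrow> Some x \<in> G" using G w by (auto simp: openin_P1_iff)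
        have "x \<in> Some -` (P1_inv -` G)" if "x \<in> ball 0 (1 / (\<bar>B\<bar> + 1))" for x
        proof (cases "x = 0")
          case True then show ?thesis using w \<open>w = 0\<close> by simp
        next
          case False
          have "norm x * (\<bar>B\<bar> + 1) < 1" using that by (simp add: pos_less_divide_eq)
          then have "\<bar>B\<bar> + 1 < 1 / norm x" using False by (simp add: pos_less_divide_eq mult.commute)
          then have "B < norm (inverse x)" by (simp add: norm_divide inverse_eq_divide)
          then show ?thesis using B[of "inverse x"] False by simp
        qed
        then show ?thesis using True by (intro exI[of _ "ball 0 (1 / (\<bar>B\<bar> + 1))"]) auto
      next
        case False
        have "open ((-{0}) \<inter> inverse -` (Some -` G))"
          by (intro continuous_open_preimage continuous_intros G') auto
        then show ?thesis using w False
          by (intro exI[of _ "(-{0}) \<inter> inverse -` (Some -` G)"]) auto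
      qed
    qed
    moreover have "\<exists>B. \<forall>w. B < norm w \<longrightarrow> Some w \<in> P1_inv -` G" if "None \<in> P1_inv -` G"
    proof -
      have "0 \<in> Some -` G" using that by simp
      then obtain e where e: "e > 0" "ball 0 e \<subseteq> Some -` G" using G' open_contains_ball by blast
      have "Some w \<in> P1_inv -` G" if "1 / e < norm w" for w
      proof -
        have w: "w \<noteq> 0" using that e by auto
        have "1 < norm w * e" using that e by (simp add: pos_divide_less_eq)
        then have "1 / norm w < e" using w by (simp add: pos_divide_less_eq mult.commute)
        then have "inverse w \<in> ball 0 e" by (simp add: norm_divide inverse_eq_divide)
        then show ?thesis using e w by auto
      qed
      then show ?thesis by blast
    qed
    ultimately show ?thesis unfolding openin_P1_iff[of "P1_inv -` G"] by blast
  qed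
  then show ?thesis by (auto simp: continuous_map_def topspace_P1 vimage_def)
qed

lemma homeomorphic_map_P1_inv: "homeomorphic_map P1 P1 P1_inv"
  unfolding homeomorphic_map_maps homeomorphic_maps_def
  using continuous_map_P1_inv by (intro exI[of _ P1_inv]) simp

lemma P1_chart_cases:
  assumes "(U, c) \<in> P1_charts"
  obtains "U = range Some" "c = the"
    | "U = P1_inv ` range Some" "\<And>z. z \<in> U \<Longrightarrow> c z = the (P1_inv z)"
proof -
  have "- {Some 0} = P1_inv ` range Some"
    by (auto simp: P1_inv_eq_iff image_iff) (metis P1_inv_simps(1,4) option.exhaust)
  moreover have "(case z of None \<Rightarrow> 0 | Some w \<Rightarrow> inverse w) = the (P1_inv z)" if "z \<noteq> Some 0" for z
    using that by (auto simp: P1_inv_def split: option.splits)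
  ultimately show thesis using assms that unfolding P1_charts_def by auto
qed

lemma homeomorphic_map_the: "homeomorphic_map (subtopology P1 (range Some)) euclidean the"
proof -
  have o: "openin P1 (range Some)" by (auto simp: openin_P1_iff)
  have "openin P1 {x \<in> range Some. the x \<in> U}" if "open U" for U
  proof -
    have "{x \<in> range Some. the x \<in> U} = Some ` U" by auto
    then show ?thesis using that by simp
  qed
  then have "continuous_map (subtopology P1 (range Some)) euclidean the"
    using o by (auto simp: continuous_map_def openin_open_subtopology)
  moreover have "open_map (subtopology P1 (range Some)) euclidean the"
    unfolding open_map_def openin_open_subtopology[OF o]
  proof (intro allI impI)
    fix G assume G: "openin P1 G \<and> G \<subseteq> range Some"
    then have "the ` G = Some -` G" by force
    then show "openin euclidean (the ` G)" using G by (simp add: openin_P1_iff)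
  qed
  moreover have "the ` topspace (subtopology P1 (range Some)) = topspace euclidean"
    by (simp add: topspace_P1 image_image)
  moreover have "inj_on the (topspace (subtopology P1 (range Some)))"
    by (auto simp: inj_on_def topspace_P1)
  ultimately show ?thesis by (rule bijective_open_imp_homeomorphic_map)
qed

lemma homeomorphic_map_P1_chart:
  assumes "(U, c) \<in> P1_charts"
  shows "openin P1 U" "homeomorphic_map (subtopology P1 U) euclidean c"
proof -
  have o: "openin P1 (range Some)" by (auto simp: openin_P1_iff)
  show "openin P1 U"
    using assms
  proof (cases rule: P1_chart_cases)
    case 1 then show ?thesis using o by simp
  next
    case 2
    then show ?thesis using o homeomorphic_map_P1_inv homeomorphic_imp_open_map open_map_def by metis
  qed
  show "homeomorphic_map (subtopology P1 U) euclidean c"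
    using assms
  proof (cases rule: P1_chart_cases)
    case 1 then show ?thesis using homeomorphic_map_the by simp
  next
    case 2
    have "P1_inv ` U = range Some" using 2(1) by (force simp: image_iff)
    then have "homeomorphic_map (subtopology P1 U) (subtopology P1 (range Some)) P1_inv"
      by (intro homeomorphic_map_subtopologies[OF homeomorphic_map_P1_inv]) (auto simp: topspace_P1)
    then have "homeomorphic_map (subtopology P1 U) euclidean (the \<circ> P1_inv)"
      using homeomorphic_map_the by (rule homeomorphic_map_compose)
    then show ?thesis by (rule homeomorphic_map_eq) (use 2 in auto)
  qed
qed

lemma P1_chart_bij:
  assumes "(U, c) \<in> P1_charts"
  shows "inj_on c U" "c ` U = UNIV" "z \<in> U \<Longrightarrow> inv_into U c (c z) = z" "inv_into U c w \<in> U"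
    "c (inv_into U c w) = w"
proof -
  note h = homeomorphic_map_P1_chart[OF assms]
  show inj: "inj_on c U" using homeomorphic_imp_injective_map[OF h(2)] by (simp add: topspace_P1)
  show im: "c ` U = UNIV" using homeomorphic_imp_surjective_map[OF h(2)] by (simp add: topspace_P1)
  show "z \<in> U \<Longrightarrow> inv_into U c (c z) = z" using inj by simp
  show "inv_into U c w \<in> U" "c (inv_into U c w) = w"
    using inv_into_into[of w c U] f_inv_into_f[of w c U] im by auto
qed

lemma P1_chart_exists: obtains U c where "(U, c) \<in> P1_charts" "z \<in> U"
proof (cases z)
  case None
  then show ?thesis by (intro that[of "- {Some 0}"]) (auto simp: P1_charts_def)
next
  case Some
  then show ?thesis by (intro that[of "range Some"]) (auto simp: P1_charts_def)
qed

lemma P1_chart_open_image: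
  assumes "(U, c) \<in> P1_charts" "openin P1 G" "G \<subseteq> U"
  shows "open (c ` G)"
proof -
  have "openin (subtopology P1 U) G" 
    using assms homeomorphic_map_P1_chart(1)[OF assms(1)] by (simp add: openin_open_subtopology)
  then show ?thesis
    using homeomorphic_map_P1_chart(2)[OF assms(1)] homeomorphic_imp_open_map
    unfolding open_map_def by (metis open_openin)
qed

lemma P1_chart_open_preimage:
  assumes "(U, c) \<in> P1_charts" "open B"
  shows "openin P1 {z \<in> U. c z \<in> B}"
proof -
  have "openin (subtopology P1 U) {z \<in> topspace (subtopology P1 U). c z \<in> B}"
    using homeomorphic_map_P1_chart(2)[OF assms(1)] assms(2)
    by (intro openin_continuous_map_preimage[of _ euclidean] homeomorphic_imp_continuous_map) auto
  then show ?thesis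
    using homeomorphic_map_P1_chart(1)[OF assms(1)]
    by (simp add: openin_open_subtopology topspace_P1)
qed

section \<open>Joint continuity of holomorphic motions\<close>

text \<open>If \<open>\<bar>X u\<bar> \<ge> \<epsilon>\<close>, Schottky's theorem for \<open>1/X\<close> on a disc around \<open>u\<close> that contains the origin well
  inside bounds \<open>1 / \<bar>X 0\<bar>\<close> by a constant that depends only on \<open>\<epsilon>\<close>.\<close>

lemma Schottky_small:
  assumes "\<epsilon> > 0"
  obtains \<delta> where "\<delta> > 0"
    "\<And>X (u::complex). X holomorphic_on ball 0 1 \<Longrightarrow> (\<And>w. w \<in> ball 0 1 \<Longrightarrow> X w \<noteq> 0 \<and> X w \<noteq> 1) \<Longrightarrow>
       norm (X 0) < \<delta> \<Longrightarrow> norm u \<le> 1/3 \<Longrightarrow> norm (X u) < \<epsilon>"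
proof -
  define K where "K = exp (pi * exp (pi * (2 + 2 * (1 / \<epsilon>) + 12 * (2/3) / (1 - 2/3 :: real))))"
  have K: "K > 0" by (simp add: K_def)
  show thesis
  proof (rule that[of "1 / K"])
    show "1 / K > 0" using K by simp
    fix X :: "complex \<Rightarrow> complex" and u :: complex
    assume hol: "X holomorphic_on ball 0 1" and avoid: "\<And>w. w \<in> ball 0 1 \<Longrightarrow> X w \<noteq> 0 \<and> X w \<noteq> 1"
      and X0: "norm (X 0) < 1 / K" and u: "norm u \<le> 1/3"
    show "norm (X u) < \<epsilon>"
    proof (rule ccontr)
      assume large: "\<not> norm (X u) < \<epsilon>"
      have in_ball: "u + w / 2 \<in> ball 0 1" if "w \<in> cball 0 1" for w
        using norm_triangle_ineq[of u "w / 2"] u that by (simp add: norm_divide)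
      define g where "g w = inverse (X (u + w / 2))" for w
      have "norm (g (- 2 * u)) \<le> K" unfolding K_def
      proof (rule Schottky[of g])
        have "X \<circ> (\<lambda>w. u + w / 2) holomorphic_on cball 0 1"
          using in_ball by (intro holomorphic_on_compose_gen[OF _ hol] holomorphic_intros) auto
        then show "g holomorphic_on cball 0 1" unfolding g_def
          using avoid[OF in_ball] by (intro holomorphic_intros) (auto simp: o_def)
        show "\<not> (g w = 0 \<or> g w = 1)" if "w \<in> cball 0 1" for w
          using avoid[OF in_ball[OF that]] by (simp add: g_def inverse_eq_1_iff)
        show "norm (g 0) \<le> 1 / \<epsilon>"
          using large assms by (simp add: g_def norm_divide inverse_eq_divide frac_le)
      qed (use u in \<open>auto simp: norm_mult\<close>)
      then have "1 / norm (X 0) \<le> K" by (simp add: g_def norm_divide inverse_eq_divide)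
      moreover have "norm (X 0) > 0" using avoid[of 0] by simp
      ultimately show False using X0 K by (simp add: field_simps)
    qed
  qed
qed

text \<open>Holomorphic maps of the unit disc into the sphere, written with the two coordinates \<open>z\<close> and \<open>1/z\<close>.\<close>

definition P1_disc :: "(complex \<Rightarrow> complex option) \<Rightarrow> bool" where
  "P1_disc p \<longleftrightarrow> continuous_map (top_of_set (ball 0 1)) P1 p \<and>
     (\<forall>u\<in>ball 0 1. (p u \<noteq> None \<longrightarrow> (the \<circ> p) field_differentiable (at u)) \<and>
        (p u \<noteq> Some 0 \<longrightarrow> (the \<circ> P1_inv \<circ> p) field_differentiable (at u)))"

lemma P1_disc_inv:
  assumes "P1_disc p"
  shows "P1_disc (P1_inv \<circ> p)"
proof -
  have "the \<circ> P1_inv \<circ> (P1_inv \<circ> p) = the \<circ> p" by (auto simp: fun_eq_iff)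
  then show ?thesis
    using assms continuous_map_compose[OF _ continuous_map_P1_inv]
    by (auto simp: P1_disc_def simp flip: o_assoc)
qed

lemma P1_eventually_in_open:
  assumes "continuous_map (top_of_set (ball 0 1)) P1 p" "u \<in> ball 0 1" "openin P1 G" "p u \<in> G"
  shows "\<forall>\<^sub>F v in nhds u. p v \<in> G"
proof -
  have "openin (top_of_set (ball 0 1)) {v \<in> topspace (top_of_set (ball 0 1)). p v \<in> G}"
    using assms by (intro openin_continuous_map_preimage[of _ P1]) auto
  then have "open {v \<in> ball 0 1. p v \<in> G}" by (simp add: openin_open_eq)
  then show ?thesis
    using assms by (auto simp: eventually_nhds intro!: exI[of _ "{v \<in> ball 0 1. p v \<in> G}"])
qed

lemma field_differentiable_cong_eventually:
  assumes "f field_differentiable (at u)" "\<forall>\<^sub>F w in nhds u. f w = g w"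
  shows "g field_differentiable (at u)"
  using assms unfolding field_differentiable_def by (metis DERIV_cong_ev)

text \<open>The cross ratio of a moving point \<open>p\<close> of the sphere with three moving finite points. The value \<open>1\<close>
  of \<open>r\<close> at \<open>p u = \<infinity>\<close> is its limit, and there the coordinate \<open>1/z\<close> shows that \<open>r\<close> is holomorphic.\<close>

lemma P1_disc_cross_ratio:
  fixes a b c :: "complex \<Rightarrow> complex"
  assumes p: "P1_disc p"
    and hol: "a holomorphic_on ball 0 1" "b holomorphic_on ball 0 1" "c holomorphic_on ball 0 1"
    and ne: "\<And>u. u \<in> ball 0 1 \<Longrightarrow> a u \<noteq> b u \<and> a u \<noteq> c u \<and> b u \<noteq> c u"
    and pne: "\<And>u. u \<in> ball 0 1 \<Longrightarrow> p u \<noteq> Some (a u) \<and> p u \<noteq> Some (b u) \<and> p u \<noteq> Some (c u)"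
  defines "r \<equiv> \<lambda>u. (case p u of None \<Rightarrow> 1 | Some w \<Rightarrow> (w - a u) / (w - c u))"
  defines "X \<equiv> \<lambda>u. (b u - c u) / (b u - a u) * r u"
  shows "X holomorphic_on ball 0 1" "\<And>u. u \<in> ball 0 1 \<Longrightarrow> X u \<noteq> 0 \<and> X u \<noteq> 1"
proof -
  have pc: "continuous_map (top_of_set (ball 0 1)) P1 p" using p by (simp add: P1_disc_def)
  have fd: "f field_differentiable (at u)" if "f holomorphic_on ball 0 1" "u \<in> ball 0 1" for f and u :: complex
    using that by (simp add: holomorphic_on_open field_differentiable_def) 
  have r_fd: "r field_differentiable (at u)" if u: "u \<in> ball 0 1" for u
  proof (cases "p u")
    case None
    define v where "v = the \<circ> P1_inv \<circ> p"
    have vd: "v field_differentiable (at u)" using p u None by (auto simp: P1_disc_def v_def)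
    have "openin P1 (- {Some 0})"
      by (auto simp: openin_P1_iff intro!: exI[of _ 0] open_Collect_neq simp: vimage_def)
    then have ev: "\<forall>\<^sub>F w in nhds u. p w \<in> - {Some 0}"
      by (intro P1_eventually_in_open[OF pc u]) (use None in auto)
    have "\<forall>\<^sub>F w in nhds u. w \<in> ball 0 1" using u by (intro eventually_nhds_in_open) auto
    with ev have ev': "\<forall>\<^sub>F w in nhds u. (1 - a w * v w) / (1 - c w * v w) = r w"
    proof eventually_elim
      case (elim w)
      show ?case
      proof (cases "p w")
        case None then show ?thesis by (simp add: v_def r_def)
      next
        case (Some x)
        then have "x \<noteq> 0" using elim by auto
        moreover have "x \<noteq> c w" using pne[of w] elim Some by auto
        ultimately show ?thesis using Some by (simp add: v_def r_def divide_simps) 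
      qed
    qed
    have v0: "v u = 0" using None by (simp add: v_def)
    have "(\<lambda>w. (1 - a w * v w) / (1 - c w * v w)) field_differentiable (at u)"
      using fd[OF hol(1) u] fd[OF hol(3) u] vd v0
      by (intro field_differentiable_divide field_differentiable_diff field_differentiable_mult) auto
    then show ?thesis
      using ev' by (rule field_differentiable_cong_eventually)
  next
    case (Some x)
    have td: "(the \<circ> p) field_differentiable (at u)" using p u Some by (auto simp: P1_disc_def)
    have "\<forall>\<^sub>F w in nhds u. p w \<in> range Some"
      by (rule P1_eventually_in_open[OF pc u]) (use Some in \<open>auto simp: openin_P1_iff\<close>)
    then have ev': "\<forall>\<^sub>F w in nhds u. ((the \<circ> p) w - a w) / ((the \<circ> p) w - c w) = r w"
      by eventually_elim (auto simp: r_def)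
    have "x \<noteq> c u" using pne[OF u] Some by auto
    then have "(\<lambda>w. ((the \<circ> p) w - a w) / ((the \<circ> p) w - c w)) field_differentiable (at u)"
      using fd[OF hol(1) u] fd[OF hol(3) u] td[unfolded o_def] Some unfolding o_def
      by (intro field_differentiable_divide field_differentiable_diff) auto
    then show ?thesis using ev' by (rule field_differentiable_cong_eventually)
  qed
  then have "r holomorphic_on ball 0 1"
    by (simp add: holomorphic_on_def field_differentiable_at_within)
  moreover have ba: "b u - a u \<noteq> 0" if "u \<in> ball 0 1" for u using ne[OF that] by auto
  ultimately show "X holomorphic_on ball 0 1" unfolding X_def using hol
    by (intro holomorphic_intros) auto
  show "X u \<noteq> 0 \<and> X u \<noteq> 1" if u: "u \<in> ball 0 1" for u
  proof (cases "p u")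
    case None
    then show ?thesis using ne[OF u] ba[OF u] by (auto simp: X_def r_def divide_eq_1_iff)
  next
    case (Some x)
    have x: "x \<noteq> a u" "x \<noteq> b u" "x \<noteq> c u" using pne[OF u] Some by auto
    then have "X u \<noteq> 0" using ne[OF u] ba[OF u] Some by (simp add: X_def r_def)
    moreover have "X u \<noteq> 1"
    proof
      assume "X u = 1"
      then have "(b u - c u) * (x - a u) = (b u - a u) * (x - c u)"
        using x ba[OF u] Some by (simp add: X_def r_def divide_simps)
      then have "(x - b u) * (c u - a u) = 0" by algebra
      then show False using x ne[OF u] by auto
    qed
    ultimately show ?thesis by blast
  qed
qed

lemma P1_disc_finite_holomorphic:
  assumes "P1_disc p" "\<And>u. u \<in> ball 0 1 \<Longrightarrow> p u \<noteq> None"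
  shows "(\<lambda>u. the (p u)) holomorphic_on ball 0 1"
  using assms unfolding P1_disc_def holomorphic_on_def o_def
  by (auto intro: field_differentiable_at_within)

lemma openin_P1_Some_image: "open B \<Longrightarrow> openin P1 (Some ` B)"
  by simp

text \<open>What the proof of joint continuity uses of the holomorphic dependence on the parameter: every
  parameter near \<open>l0\<close> is the value at \<open>1/3\<close> of a disc centred at \<open>l0\<close> along which all points move
  holomorphically. In this form the property passes to the motion composed with \<open>P1_inv\<close>.\<close>

definition disc_reachable ::
    "'m topology \<Rightarrow> ('m \<Rightarrow> complex option \<Rightarrow> complex option) \<Rightarrow> 'm \<Rightarrow> bool" where
  "disc_reachable M \<phi> l0 \<longleftrightarrow> (\<forall>N. openin M N \<and> l0 \<in> N \<longrightarrow>
     (\<exists>N'. openin M N' \<and> l0 \<in> N' \<and> N' \<subseteq> N \<and>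
        (\<forall>l\<in>N'. \<exists>\<sigma>. \<sigma> ` ball 0 1 \<subseteq> N \<and> \<sigma> 0 = l0 \<and> \<sigma> (1/3) = l \<and>
           (\<forall>z. P1_disc (\<lambda>u. \<phi> (\<sigma> u) z)))))"

text \<open>Choose \<open>b\<close> and \<open>c\<close> with images \<open>A0 + 1\<close> and \<open>A0 + 2\<close> under \<open>\<phi> l0\<close>, where \<open>A0\<close> is the image of \<open>z0\<close>. For \<open>z\<close>
  close to \<open>z0\<close> the cross ratio \<open>X\<close> of the images of \<open>z, z0, b, c\<close> is small at \<open>l0\<close>, hence small
  at nearby \<open>l\<close> by \<open>Schottky_small\<close>. The images of \<open>z0, b, c\<close> barely move, so the image of \<open>z\<close>
  must stay close to that of \<open>z0\<close>.\<close>

lemma motion_continuous_at_finite: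
  fixes \<phi> :: "'m \<Rightarrow> complex option \<Rightarrow> complex option"
  assumes l0: "l0 \<in> topspace M"
    and cont: "\<And>z. continuous_map M P1 (\<lambda>l. \<phi> l z)"
    and homeo: "\<And>l. l \<in> topspace M \<Longrightarrow> homeomorphic_map P1 P1 (\<phi> l)"
    and discs: "disc_reachable M \<phi> l0"
    and fin: "\<phi> l0 z0 \<noteq> None" and G: "openin P1 G" "\<phi> l0 z0 \<in> G"
  shows "\<exists>N Z. openin M N \<and> l0 \<in> N \<and> openin P1 Z \<and> z0 \<in> Z \<and> (\<forall>l\<in>N. \<forall>z\<in>Z. \<phi> l z \<in> G)"
proof -
  have inj: "\<phi> l z = \<phi> l z' \<longleftrightarrow> z = z'" if "l \<in> topspace M" for l z z'
    using homeomorphic_imp_injective_map[OF homeo[OF that]] by (auto simp: inj_on_def)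
  have surj: "\<exists>z. \<phi> l0 z = w" for w
    using homeomorphic_imp_surjective_map[OF homeo[OF l0]] by (metis UNIV_I imageE topspace_P1)
  obtain A0 where A0: "\<phi> l0 z0 = Some A0" using fin by blast
  obtain b c where b: "\<phi> l0 b = Some (A0 + 1)" and c: "\<phi> l0 c = Some (A0 + 2)" using surj by metis
  have "open (Some -` G)" "A0 \<in> Some -` G" using G A0 by (auto simp: openin_P1_iff)
  then obtain e0 where e0: "e0 > 0" "ball A0 e0 \<subseteq> Some -` G" using open_contains_ball by blast
  define \<epsilon> where "\<epsilon> = min (1/6) (e0 / 60)"
  have \<epsilon>: "\<epsilon> > 0" "\<epsilon> \<le> 1/6" "\<epsilon> \<le> e0 / 60" using e0 by (auto simp: \<epsilon>_def)
  obtain \<delta> where \<delta>: "\<delta> > 0"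
    "\<And>X (u::complex). X holomorphic_on ball 0 1 \<Longrightarrow> (\<And>w. w \<in> ball 0 1 \<Longrightarrow> X w \<noteq> 0 \<and> X w \<noteq> 1) \<Longrightarrow>
       norm (X 0) < \<delta> \<Longrightarrow> norm u \<le> 1/3 \<Longrightarrow> norm (X u) < \<epsilon>"
    using Schottky_small[OF \<epsilon>(1)] by blast
  \<comment> \<open>On \<open>N\<close> the images of \<open>z0, b, c\<close> are finite and stay close to \<open>A0, A0 + 1, A0 + 2\<close>.\<close>
  define N where "N = {l \<in> topspace M. \<phi> l z0 \<in> Some ` ball A0 (min (e0/2) (1/4))} \<inter>
     {l \<in> topspace M. \<phi> l b \<in> Some ` ball (A0 + 1) (1/4)} \<inter>
     {l \<in> topspace M. \<phi> l c \<in> Some ` ball (A0 + 2) (1/4)}"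
  have "openin M N" unfolding N_def
    by (intro openin_Int openin_continuous_map_preimage[OF cont] openin_P1_Some_image open_ball)
  moreover have "l0 \<in> N" using l0 A0 b c e0 by (auto simp: N_def)
  ultimately obtain N' where N': "openin M N'" "l0 \<in> N'" "N' \<subseteq> N"
    "\<And>l. l \<in> N' \<Longrightarrow> \<exists>\<sigma>. \<sigma> ` ball 0 1 \<subseteq> N \<and> \<sigma> 0 = l0 \<and> \<sigma> (1/3) = l \<and> (\<forall>z. P1_disc (\<lambda>u. \<phi> (\<sigma> u) z))"
    using discs unfolding disc_reachable_def by meson
  define \<eta> where "\<eta> = min \<delta> (1/2)"
  define Z where "Z = {z \<in> topspace P1. \<phi> l0 z \<in> Some ` ball A0 \<eta>}"
  have \<eta>: "\<eta> > 0" "\<eta> \<le> \<delta>" "\<eta> \<le> 1/2" using \<delta>(1) by (auto simp: \<eta>_def)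
  have "openin P1 Z" unfolding Z_def
    by (intro openin_continuous_map_preimage[OF homeomorphic_imp_continuous_map[OF homeo[OF l0]]]
        openin_P1_Some_image open_ball)
  moreover have "z0 \<in> Z" using A0 \<eta> by (simp add: Z_def)
  moreover have "\<phi> l z \<in> G" if l: "l \<in> N'" and z: "z \<in> Z" for l z
  proof (cases "z = z0")
    case True
    have "l \<in> N" using N'(3) l by blast
    then obtain x where "\<phi> l z0 = Some x" "x \<in> ball A0 (min (e0/2) (1/4))" by (auto simp: N_def)
    moreover from this have "x \<in> ball A0 e0" using e0(1) by auto
    ultimately show ?thesis using e0(2) True by auto
  next
    case False
    obtain \<sigma> where \<sigma>: "\<sigma> ` ball 0 1 \<subseteq> N" "\<sigma> 0 = l0" "\<sigma> (1/3) = l" "\<And>z. P1_disc (\<lambda>u. \<phi> (\<sigma> u) z)"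
      using N'(4)[OF l] by blast
    obtain w0 where w0: "\<phi> l0 z = Some w0" "norm (w0 - A0) < \<eta>" 
      using z by (auto simp: Z_def dist_norm norm_minus_commute)
    have zb: "z \<noteq> b" using w0 b \<eta> by auto
    have zc: "z \<noteq> c" using w0 c \<eta> by auto
    define A B C where "A l = the (\<phi> l z0)" and "B l = the (\<phi> l b)" and "C l = the (\<phi> l c)" for l
    have N_Some: "\<phi> k z0 = Some (A k)" "\<phi> k b = Some (B k)" "\<phi> k c = Some (C k)"
      and N_near: "dist A0 (A k) < e0/2" "dist A0 (A k) < 1/4" "dist (A0 + 1) (B k) < 1/4" "dist (A0 + 2) (C k) < 1/4"
      and NM: "k \<in> topspace M"
      if "k \<in> N" for k using that by (auto simp: N_def A_def B_def C_def)
    have abc: "z0 \<noteq> b" "z0 \<noteq> c" "b \<noteq> c" using A0 b c by auto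
    have \<sigma>N: "\<sigma> u \<in> N" if "u \<in> ball 0 1" for u using \<sigma>(1) that by blast
    define r where "r u = (case \<phi> (\<sigma> u) z of None \<Rightarrow> 1 | Some w \<Rightarrow> (w - A (\<sigma> u)) / (w - C (\<sigma> u)))" for u
    define X where "X u = (B (\<sigma> u) - C (\<sigma> u)) / (B (\<sigma> u) - A (\<sigma> u)) * r u" for u
    have hol: "(\<lambda>u. A (\<sigma> u)) holomorphic_on ball 0 1" "(\<lambda>u. B (\<sigma> u)) holomorphic_on ball 0 1"
       "(\<lambda>u. C (\<sigma> u)) holomorphic_on ball 0 1"
      unfolding A_def B_def C_def using N_Some \<sigma>N
      by (intro P1_disc_finite_holomorphic \<sigma>(4); metis option.distinct(1))+
    have ne: "A (\<sigma> u) \<noteq> B (\<sigma> u) \<and> A (\<sigma> u) \<noteq> C (\<sigma> u) \<and> B (\<sigma> u) \<noteq> C (\<sigma> u)" if "u \<in> ball 0 1" for u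
      using N_Some[OF \<sigma>N[OF that]] inj[OF NM[OF \<sigma>N[OF that]]] abc by metis
    have pne: "\<phi> (\<sigma> u) z \<noteq> Some (A (\<sigma> u)) \<and> \<phi> (\<sigma> u) z \<noteq> Some (B (\<sigma> u)) \<and> \<phi> (\<sigma> u) z \<noteq> Some (C (\<sigma> u))"
      if "u \<in> ball 0 1" for u
      using N_Some[OF \<sigma>N[OF that]] inj[OF NM[OF \<sigma>N[OF that]]] False zb zc by metis
    note cr = P1_disc_cross_ratio[OF \<sigma>(4) hol ne pne, folded r_def, folded X_def]
    have "norm (X 0) = norm (w0 - A0) / norm (w0 - A0 - 2)"
      using A0 b c w0 \<sigma>(2) by (simp add: X_def r_def A_def B_def C_def norm_mult norm_divide
          diff_diff_eq norm_minus_commute)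
    also have "\<dots> \<le> norm (w0 - A0) / 1"
    proof (intro divide_left_mono)
      show "1 \<le> norm (w0 - A0 - 2)"
        using norm_triangle_ineq2[of 2 "w0 - A0"] w0(2) \<eta> by (simp add: norm_minus_commute)
    qed (use w0 \<eta> in auto)
    also have "\<dots> < \<delta>" using w0 \<eta> by simp
    finally have "norm (X (1/3)) < \<epsilon>" using cr by (intro \<delta>(2)) auto
    have lN: "l \<in> N" using l N' by blast
    have near: "norm (B l - A l) \<le> 3/2" "norm (A l - C l) \<le> 5/2" "1/2 \<le> norm (B l - C l)"
    proof -
      define x y v where "x = A l - A0" and "y = B l - (A0 + 1)" and "v = C l - (A0 + 2)"
      have xyv: "norm x < 1/4" "norm y < 1/4" "norm v < 1/4"
        using N_near[OF lN] by (auto simp: dist_norm norm_minus_commute x_def y_def v_def)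
      have "B l - A l = 1 + (y - x)" "A l - C l = -2 + (x - v)" "B l - C l = -1 - (v - y)"
        by (simp_all add: x_def y_def v_def)
      then show "norm (B l - A l) \<le> 3/2" "norm (A l - C l) \<le> 5/2" "1/2 \<le> norm (B l - C l)"
        using xyv norm_triangle_ineq[of 1 "y - x"] norm_triangle_ineq[of "-2" "x - v"]
          norm_triangle_ineq2[of "-1" "v - y"] norm_triangle_ineq4[of y x]
          norm_triangle_ineq4[of x v] norm_triangle_ineq4[of v y] by simp_all
    qed
    have "norm (r (1/3)) = norm (X (1/3)) * (norm (B l - A l) / norm (B l - C l))"
      using ne[of "1/3"] \<sigma>(3) by (auto simp: X_def norm_mult norm_divide)
    also have "\<dots> \<le> \<epsilon> * 3"
    proof (intro mult_mono)
      show "norm (B l - A l) / norm (B l - C l) \<le> 3" using near(1,3) by (simp add: divide_le_eq)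
    qed (use \<open>norm (X (1/3)) < \<epsilon>\<close> \<epsilon>(1) in auto)
    finally have r: "norm (r (1/3)) \<le> 3 * \<epsilon>" by simp
    show ?thesis
    proof (cases "\<phi> l z")
      case None
      then have "r (1/3) = 1" using \<sigma>(3) by (simp add: r_def)
      then show ?thesis using r \<epsilon> by simp
    next
      case (Some w)
      have wC: "w \<noteq> C l" using pne[of "1/3"] Some \<sigma>(3) by auto
      have "norm (w - A l) = norm (r (1/3)) * norm (w - C l)"
        using Some wC \<sigma>(3) by (simp add: r_def norm_divide)
      also have "\<dots> \<le> (3 * \<epsilon>) * (norm (w - A l) + norm (A l - C l))"
        using r \<epsilon>(1) norm_triangle_ineq[of "w - A l" "A l - C l"] by (intro mult_mono) auto
      also have "\<dots> \<le> (3 * \<epsilon>) * norm (w - A l) + (3 * \<epsilon>) * (5/2)" 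
      proof -
        show ?thesis using \<epsilon>(1) near(2) by (simp only: distrib_left) (intro add_left_mono mult_left_mono, auto)
      qed
      also have "(3 * \<epsilon>) * norm (w - A l) \<le> 1/2 * norm (w - A l)" using \<epsilon> by (intro mult_right_mono) auto
      finally have "norm (w - A l) \<le> 15 * \<epsilon>" by simp
      then have "norm (w - A l) < e0 / 2" using \<epsilon> e0 by simp
      then have "dist A0 w < e0"
        using N_near(1)[OF lN] dist_triangle[of A0 w "A l"] by (simp add: dist_norm norm_minus_commute)
      then show ?thesis using e0 Some by auto
    qed
  qed
  ultimately show ?thesis using N' by blast
qed

text \<open>Where \<open>\<phi> l0 z0\<close> is the point at infinity, the preceding lemma applies to the motion composed with
  the coordinate change \<open>1/z\<close>.\<close>

lemma motion_continuous:
  fixes \<phi> :: "'m \<Rightarrow> complex option \<Rightarrow> complex option"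
  assumes cont: "\<And>z. continuous_map M P1 (\<lambda>l. \<phi> l z)"
    and homeo: "\<And>l. l \<in> topspace M \<Longrightarrow> homeomorphic_map P1 P1 (\<phi> l)"
    and discs: "\<And>l. l \<in> topspace M \<Longrightarrow> disc_reachable M \<phi> l"
  shows "continuous_map (prod_topology M P1) P1 (\<lambda>(l, z). \<phi> l z)"
proof -
  have loc: "\<exists>N Z. openin M N \<and> l0 \<in> N \<and> openin P1 Z \<and> z0 \<in> Z \<and> (\<forall>l\<in>N. \<forall>z\<in>Z. \<phi> l z \<in> G)"
    if l0: "l0 \<in> topspace M" and G: "openin P1 G" "\<phi> l0 z0 \<in> G" for l0 z0 G
  proof (cases "\<phi> l0 z0 = None")
    case False
    then show ?thesis by (intro motion_continuous_at_finite assms that)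
  next
    case True
    have "\<exists>N Z. openin M N \<and> l0 \<in> N \<and> openin P1 Z \<and> z0 \<in> Z \<and>
        (\<forall>l\<in>N. \<forall>z\<in>Z. (\<lambda>l z. P1_inv (\<phi> l z)) l z \<in> P1_inv ` G)"
    proof (rule motion_continuous_at_finite[OF l0])
      show "continuous_map M P1 (\<lambda>l. P1_inv (\<phi> l z))" for z
        using continuous_map_compose[OF cont continuous_map_P1_inv] by (simp add: o_def)
      show "homeomorphic_map P1 P1 (\<lambda>z. P1_inv (\<phi> l z))" if "l \<in> topspace M" for l
        using homeomorphic_map_compose[OF homeo[OF that] homeomorphic_map_P1_inv] by (simp add: o_def)
      have "P1_disc (\<lambda>u. P1_inv (p u))" if "P1_disc p" for p
        using P1_disc_inv[OF that] by (simp add: o_def)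
      then show "disc_reachable M (\<lambda>l z. P1_inv (\<phi> l z)) l0"
        using discs[OF l0] unfolding disc_reachable_def by meson
      show "openin P1 (P1_inv ` G)"
        using homeomorphic_imp_open_map[OF homeomorphic_map_P1_inv] G by (simp add: open_map_def)
    show "P1_inv (\<phi> l0 z0) \<noteq> None" using True by simp
      show "P1_inv (\<phi> l0 z0) \<in> P1_inv ` G" using G(2) by (rule imageI)
    qed
    then show ?thesis by (metis (no_types, lifting) P1_inv_simps(4) imageE)
  qed
  show ?thesis
    unfolding continuous_map_def
  proof (intro conjI allI impI funcsetI)
    fix G assume G: "openin P1 G"
    show "openin (prod_topology M P1) {x \<in> topspace (prod_topology M P1). (case x of (l, z) \<Rightarrow> \<phi> l z) \<in> G}"
      unfolding openin_prod_topology_alt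
    proof (intro allI impI)
      fix l z assume "(l, z) \<in> {x \<in> topspace (prod_topology M P1). (case x of (l, z) \<Rightarrow> \<phi> l z) \<in> G}"
      then have "l \<in> topspace M" "\<phi> l z \<in> G" by auto
      from loc[OF this(1) G this(2)] obtain N Z where NZ: "openin M N" "l \<in> N" "openin P1 Z" "z \<in> Z"
         "\<forall>l\<in>N. \<forall>z\<in>Z. \<phi> l z \<in> G" by blast
      then have "N \<times> Z \<subseteq> {x \<in> topspace (prod_topology M P1). (case x of (l, z) \<Rightarrow> \<phi> l z) \<in> G}"
        using openin_subset[OF NZ(1)] by auto
      then show "\<exists>U V. openin M U \<and> openin P1 V \<and> l \<in> U \<and> z \<in> V \<and>
          U \<times> V \<subseteq> {x \<in> topspace (prod_topology M P1). (case x of (l, z) \<Rightarrow> \<phi> l z) \<in> G}"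
        using NZ by blast
    qed
  qed auto
qed

text \<open>The pairs \<open>((l, w), z)\<close> with \<open>\<phi> l z \<noteq> w\<close> form an open set. If \<open>inv (\<phi> l) w\<close> lies in an open set \<open>G\<close>, this
  set contains \<open>{(l, w)} \<times> - G\<close>, and since \<open>- G\<close> is compact the tube lemma gives a neighbourhood
  of \<open>(l, w)\<close> on which the preimages stay in \<open>G\<close>.\<close>

lemma motion_inverse_continuous:
  fixes \<phi> :: "'m \<Rightarrow> complex option \<Rightarrow> complex option"
  assumes cont: "continuous_map (prod_topology M P1) P1 (\<lambda>(l, z). \<phi> l z)"
    and homeo: "\<And>l. l \<in> topspace M \<Longrightarrow> homeomorphic_map P1 P1 (\<phi> l)"
  shows "continuous_map (prod_topology M P1) P1 (\<lambda>(l, w). inv (\<phi> l) w)"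
proof -
  have bij: "bij (\<phi> l)" if "l \<in> topspace M" for l
    using homeo[OF that] by (simp add: homeomorphic_eq_everything_map bij_def)
  show ?thesis
    unfolding continuous_map_def
  proof (intro conjI allI impI funcsetI)
    fix G assume G: "openin P1 G"
    show "openin (prod_topology M P1) {x \<in> topspace (prod_topology M P1). (case x of (l, z) \<Rightarrow> inv (\<phi> l) z) \<in> G}"
      (is "openin _ ?S")
    proof (subst openin_subopen, intro ballI)
      fix x assume x: "x \<in> ?S"
      obtain l w where lw: "x = (l, w)" by fastforce
      then have l: "l \<in> topspace M" and w: "inv (\<phi> l) w \<in> G" using x by auto
      let ?X = "prod_topology (prod_topology M P1) P1"
      define W where "W = topspace ?X - {p \<in> topspace ?X. \<phi> (fst (fst p)) (snd p) = snd (fst p)}"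
      have c1: "continuous_map ?X P1 (\<lambda>p. \<phi> (fst (fst p)) (snd p))"
        using continuous_map_compose[OF _ cont, of ?X "\<lambda>p. (fst (fst p), snd p)"]
        by (simp add: continuous_map_pairedI continuous_map_fst_of continuous_map_snd o_def
            continuous_map_compose[OF continuous_map_fst continuous_map_fst, unfolded o_def])
      have c2: "continuous_map ?X P1 (\<lambda>p. snd (fst p))"
        using continuous_map_compose[OF continuous_map_fst continuous_map_snd] by (simp add: o_def)
      have "openin ?X W" unfolding W_def
        by (intro openin_diff openin_topspace closedin_continuous_maps_eq[OF Hausdorff_space_P1 c1 c2])
      moreover have "compactin P1 (- G)"
        using closedin_compact_space[of P1 "-G"] G
        by (simp add: closedin_def Compl_eq_Diff_UNIV[symmetric] double_compl)
      moreover have "{(l, w)} \<times> - G \<subseteq> W"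
        using l w bij[OF l] by (auto simp: W_def) (metis bij_inv_eq_iff)
      ultimately obtain U V where UV: "openin (prod_topology M P1) U" "(l, w) \<in> U" "- G \<subseteq> V" "U \<times> V \<subseteq> W"
        using tube_lemma_right[of "prod_topology M P1" P1 W "- G" "(l, w)"] l by auto
      have "y \<in> ?S" if y: "y \<in> U" for y
      proof -
        have yM: "y \<in> topspace (prod_topology M P1)" using openin_subset[OF UV(1)] y by blast
        obtain l' w' where y': "y = (l', w')" by fastforce
        have "inv (\<phi> l') w' \<in> G"
        proof (rule ccontr)
          assume "inv (\<phi> l') w' \<notin> G"
          then have "((l', w'), inv (\<phi> l') w') \<in> W" using UV(3,4) y y' by blast
          then show False using bij[of l'] yM y' by (auto simp: W_def bij_inv_eq_iff surj_f_inv_f bij_is_surj)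
        qed
        then show ?thesis using yM y' by auto
      qed
      then show "\<exists>T. openin (prod_topology M P1) T \<and> x \<in> T \<and> T \<subseteq> ?S"
        using UV lw by blast
    qed
  qed auto
qed

section \<open>Families over a complex manifold\<close>

lemma norm_vector_smult_complex: "norm (u *s (e :: complex ^ 'n)) = norm u * norm e"
  by (simp add: norm_vec_def L2_set_right_distrib norm_mult)

text \<open>In a chart, points near \<open>l0\<close> are joined to it by complex lines. The disc runs from \<open>l0\<close> three
  times as far as \<open>l\<close>, so that \<open>l\<close> is reached at the parameter \<open>1/3\<close>, where \<open>Schottky_small\<close> applies.\<close>

lemma complex_manifold_disc:
  fixes \<A> :: "('m set \<times> ('m \<Rightarrow> complex ^ 'n)) set"
  assumes M: "complex_manifold M \<A>" and l0: "l0 \<in> topspace M" and N: "openin M N" "l0 \<in> N"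
  shows "\<exists>N'. openin M N' \<and> l0 \<in> N' \<and> N' \<subseteq> N \<and>
     (\<forall>l\<in>N'. \<exists>\<sigma>. continuous_map (top_of_set (ball 0 1)) (subtopology M N) \<sigma> \<and>
         \<sigma> 0 = l0 \<and> \<sigma> (1/3) = l \<and> (\<forall>g. manifold_holomorphic_P1 M \<A> g \<longrightarrow> P1_disc (g \<circ> \<sigma>)))"
proof -
  have cover: "(\<Union>(U, c)\<in>\<A>. U) = topspace M"
    and charts: "\<And>U c. (U, c) \<in> \<A> \<Longrightarrow> openin M U \<and> open (c ` U) \<and>
        homeomorphic_map (subtopology M U) (top_of_set (c ` U)) c"
    using M unfolding complex_manifold_def by blast+
  obtain U c where Uc: "(U, c) \<in> \<A>" "l0 \<in> U"
  proof -
    have "l0 \<in> (\<Union>(U, c)\<in>\<A>. U)" using cover l0 by simp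
    then obtain p where "p \<in> \<A>" "l0 \<in> (case p of (U, c) \<Rightarrow> U)" by blast
    then show thesis using that by (cases p) simp
  qed
  define \<kappa> where "\<kappa> = inv_into U c"
  have U: "openin M U" "open (c ` U)" and hom: "homeomorphic_map (subtopology M U) (top_of_set (c ` U)) c"
    using charts[OF Uc(1)] by auto
  have UM: "U \<subseteq> topspace M" using openin_subset[OF U(1)] .
  then have tU: "topspace (subtopology M U) = U" by auto
  have inj: "inj_on c U" using homeomorphic_imp_injective_map[OF hom] tU by simp
  have \<kappa>c: "\<kappa> (c x) = x" if "x \<in> U" for x using that inj by (simp add: \<kappa>_def)
  have cont_\<kappa>: "continuous_map (top_of_set (c ` U)) (subtopology M U) \<kappa>"
  proof -
    obtain g where g: "homeomorphic_maps (subtopology M U) (top_of_set (c ` U)) c g"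
      using hom homeomorphic_map_maps by blast
    then have cg: "continuous_map (top_of_set (c ` U)) (subtopology M U) g"
      by (simp add: homeomorphic_maps_def)
    have geq: "g y = \<kappa> y" if y: "y \<in> c ` U" for y
    proof -
      obtain x where "x \<in> U" "y = c x" using y by blast
      then show ?thesis using g \<kappa>c tU by (simp add: homeomorphic_maps_def)
    qed
    show ?thesis by (rule continuous_map_eq[OF cg]) (rule geq, simp)
  qed
  have "openin (top_of_set (c ` U)) (c ` (U \<inter> N))"
    using homeomorphic_imp_open_map[OF hom] N(1) by (simp add: open_map_def openin_subtopology_Int2)
  then have "open (c ` (U \<inter> N))" using U(2) openin_open_eq by blast
  moreover have "c l0 \<in> c ` (U \<inter> N)" using Uc N by auto
  ultimately obtain \<rho> where \<rho>: "\<rho> > 0" "ball (c l0) \<rho> \<subseteq> c ` (U \<inter> N)" using open_contains_ball by blast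
  have \<kappa>_ball: "\<kappa> y \<in> U \<and> \<kappa> y \<in> N \<and> c (\<kappa> y) = y" if "y \<in> ball (c l0) \<rho>" for y
  proof -
    obtain x where "x \<in> U" "x \<in> N" "y = c x" using \<rho>(2) \<open>y \<in> ball (c l0) \<rho>\<close> by blast
    then show ?thesis by (simp add: \<kappa>c)
  qed
  define N' where "N' = N \<inter> {x \<in> topspace (subtopology M U). c x \<in> c ` U \<inter> ball (c l0) (\<rho> / 3)}"
  have "openin (subtopology M U) {x \<in> topspace (subtopology M U). c x \<in> c ` U \<inter> ball (c l0) (\<rho> / 3)}"
    by (rule openin_continuous_map_preimage[OF homeomorphic_imp_continuous_map[OF hom]])
       (simp add: openin_open_Int)
  then have "openin M N'" unfolding N'_def
    using U(1) N(1) by (meson openin_Int openin_trans_full)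
  moreover have "l0 \<in> N'" using \<rho> Uc N l0 by (auto simp: N'_def)
  moreover have "N' \<subseteq> N" by (auto simp: N'_def)
  moreover have "\<exists>\<sigma>. continuous_map (top_of_set (ball 0 1)) (subtopology M N) \<sigma> \<and>
         \<sigma> 0 = l0 \<and> \<sigma> (1/3) = l \<and> (\<forall>g. manifold_holomorphic_P1 M \<A> g \<longrightarrow> P1_disc (g \<circ> \<sigma>))"
    if l: "l \<in> N'" for l
  proof -
    \<comment> \<open>The factor \<open>3\<close> puts \<open>l\<close> at the parameter \<open>1/3\<close>; this is why \<open>N'\<close> has radius \<open>\<rho> / 3\<close>.\<close>
    define e where "e = (3::complex) *s (c l - c l0)"
    have lU: "l \<in> U" and "norm (c l - c l0) < \<rho> / 3"
      using l tU by (auto simp: N'_def dist_norm norm_minus_commute)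
    then have e: "norm e < \<rho>" by (simp only: e_def norm_vector_smult_complex) simp
    define line where "line u = c l0 + u *s e" for u :: complex
    have line_ball: "line u \<in> ball (c l0) \<rho>" if "u \<in> ball 0 1" for u
    proof -
      have "norm u * norm e \<le> 1 * norm e" using that by (intro mult_right_mono) auto
      then show ?thesis using e by (simp add: line_def dist_norm norm_vector_smult_complex)
    qed
    have blin: "bounded_linear (\<lambda>u::complex. u *s e)"
      by (subst linear_conv_bounded_linear[symmetric])
         (auto intro!: linearI simp: vec_eq_iff algebra_simps)
    have cont_line: "continuous_on (ball 0 1) line"
      unfolding line_def by (intro continuous_intros linear_continuous_on blin)
    define \<sigma> where "\<sigma> = \<kappa> \<circ> line"
    have \<sigma>N: "\<sigma> u \<in> U \<and> \<sigma> u \<in> N" if "u \<in> ball 0 1" for u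
      using \<kappa>_ball[OF line_ball[OF that]] by (simp add: \<sigma>_def)
    have cm_line: "continuous_map (top_of_set (ball 0 1)) (top_of_set (c ` U)) line"
    proof -
      have "line u \<in> c ` U" if "u \<in> ball 0 1" for u using line_ball[OF that] \<rho>(2) by blast
      then show ?thesis using cont_line by (auto simp: continuous_map_in_subtopology)
    qed
    have "continuous_map (top_of_set (ball 0 1)) M \<sigma>"
      unfolding \<sigma>_def using continuous_map_compose[OF cm_line cont_\<kappa>] continuous_map_into_fulltopology by blast
    then have cont_\<sigma>: "continuous_map (top_of_set (ball 0 1)) (subtopology M N) \<sigma>"
      using \<sigma>N by (auto simp: continuous_map_in_subtopology)
    have "\<sigma> 0 = l0" using Uc by (simp add: \<sigma>_def line_def \<kappa>c)
    moreover have "line (1/3) = c l" by (simp add: line_def e_def vec_eq_iff)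
    then have "\<sigma> (1/3) = l" using lU by (simp add: \<sigma>_def \<kappa>c)
    moreover have "P1_disc (g \<circ> \<sigma>)" if g: "manifold_holomorphic_P1 M \<A> g" for g
    proof -
      have cont_g: "continuous_map (top_of_set (ball 0 1)) P1 (g \<circ> \<sigma>)"
      proof -
        have "continuous_map M P1 g" using g by (simp add: manifold_holomorphic_P1_def)
        then show ?thesis by (rule continuous_map_compose[OF \<open>continuous_map _ M \<sigma>\<close>])
      qed
      have fd: "(d \<circ> (g \<circ> \<sigma>)) field_differentiable (at u)"
        if Vd: "(V, d) \<in> P1_charts" and u: "u \<in> ball 0 1" and gV: "g (\<sigma> u) \<in> V" for V d u
      proof -
        have sh: "several_holomorphic_on (d \<circ> g \<circ> \<kappa>) (c ` {x \<in> U. g x \<in> V})"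
          using g Uc(1) Vd unfolding manifold_holomorphic_P1_def \<kappa>_def by blast
        have "line u \<in> c ` {x \<in> U. g x \<in> V}"
          using \<kappa>_ball[OF line_ball[OF u]] gV by (auto simp: \<sigma>_def intro!: image_eqI[of _ _ "\<kappa> (line u)"])
        then obtain D where D: "(d \<circ> g \<circ> \<kappa> has_derivative D) (at (line u))" "\<And>a v. D (a *s v) = a * D v"
          using sh unfolding several_holomorphic_on_def by blast
        have "(line has_derivative (\<lambda>h. h *s e)) (at u)"
          unfolding line_def
          using has_derivative_add[OF has_derivative_const bounded_linear_imp_has_derivative[OF blin]]
          by simp
        from diff_chain_at[OF this D(1)] have "((d \<circ> g \<circ> \<kappa>) \<circ> line has_derivative (\<lambda>h. D e * h)) (at u)"
          by (simp add: o_def D(2) mult.commute)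
        then have "((d \<circ> g \<circ> \<kappa>) \<circ> line has_field_derivative D e) (at u)"
          by (simp add: has_field_derivative_def)
        then show ?thesis unfolding \<sigma>_def field_differentiable_def by (auto simp: o_assoc)
      qed
      show ?thesis unfolding P1_disc_def
      proof (intro conjI ballI impI cont_g)
        fix u :: complex assume u: "u \<in> ball 0 1"
        show "(the \<circ> (g \<circ> \<sigma>)) field_differentiable (at u)" if "(g \<circ> \<sigma>) u \<noteq> None"
          using that by (intro fd[of "range Some" the] u) (auto simp: P1_charts_def)
        show "(the \<circ> P1_inv \<circ> (g \<circ> \<sigma>)) field_differentiable (at u)" if nz: "(g \<circ> \<sigma>) u \<noteq> Some 0"
        proof -
          let ?d = "(\<lambda>z. case z of None \<Rightarrow> 0 | Some w \<Rightarrow> inverse w) :: complex option \<Rightarrow> complex"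
          have f1: "(?d \<circ> (g \<circ> \<sigma>)) field_differentiable (at u)"
            using nz by (intro fd[of "- {Some 0}"] u) (auto simp: P1_charts_def)
          have "openin P1 (- {Some 0})" 
            using homeomorphic_map_P1_chart(1)[of "- {Some 0}"] by (auto simp: P1_charts_def)
          then have "\<forall>\<^sub>F v in nhds u. (g \<circ> \<sigma>) v \<in> - {Some 0}"
            by (rule P1_eventually_in_open[OF cont_g u]) (use nz in auto)
          then have "\<forall>\<^sub>F v in nhds u. (?d \<circ> (g \<circ> \<sigma>)) v = (the \<circ> P1_inv \<circ> (g \<circ> \<sigma>)) v"
            by eventually_elim (auto simp: P1_inv_def split: option.splits)
          then show ?thesis by (rule field_differentiable_cong_eventually[OF f1])
        qed
      qed
    qed
    ultimately show ?thesis using cont_\<sigma> by blast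
  qed
  ultimately show ?thesis by blast
qed

lemma holomorphic_qc_family_homeomorphic:
  assumes "holomorphic_qc_family M \<A> \<phi>" "l \<in> topspace M"
  shows "homeomorphic_map P1 P1 (\<phi> l)" "bij (\<phi> l)"
proof -
  show "homeomorphic_map P1 P1 (\<phi> l)"
    using assms by (auto simp: holomorphic_qc_family_def quasiconformal_def)
  then show "bij (\<phi> l)" by (simp add: homeomorphic_eq_everything_map bij_def)
qed

lemma holomorphic_qc_family_continuous:
  assumes M: "complex_manifold M \<A>" and \<phi>: "holomorphic_qc_family M \<A> \<phi>"
  shows "continuous_map (prod_topology M P1) P1 (\<lambda>(l, z). \<phi> l z)"
    "continuous_map (prod_topology M P1) P1 (\<lambda>(l, w). inv (\<phi> l) w)"
proof -
  have hol: "manifold_holomorphic_P1 M \<A> (\<lambda>l. \<phi> l z)" for z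
    using \<phi> by (simp add: holomorphic_qc_family_def)
  have "disc_reachable M \<phi> l" if l: "l \<in> topspace M" for l
    unfolding disc_reachable_def
  proof (intro allI impI, elim conjE)
    fix N assume N: "openin M N" "l \<in> N"
    obtain N' where N': "openin M N'" "l \<in> N'" "N' \<subseteq> N"
      "\<And>k. k \<in> N' \<Longrightarrow> \<exists>\<sigma>. continuous_map (top_of_set (ball 0 1)) (subtopology M N) \<sigma> \<and>
         \<sigma> 0 = l \<and> \<sigma> (1/3) = k \<and> (\<forall>g. manifold_holomorphic_P1 M \<A> g \<longrightarrow> P1_disc (g \<circ> \<sigma>))"
      using complex_manifold_disc[OF M l N] by blast
    have "\<exists>\<sigma>. \<sigma> ` ball 0 1 \<subseteq> N \<and> \<sigma> 0 = l \<and> \<sigma> (1/3) = k \<and> (\<forall>z. P1_disc (\<lambda>u. \<phi> (\<sigma> u) z))"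
      if k: "k \<in> N'" for k
    proof -
      obtain \<sigma> where \<sigma>: "continuous_map (top_of_set (ball 0 1)) (subtopology M N) \<sigma>"
         "\<sigma> 0 = l" "\<sigma> (1/3) = k" "\<And>g. manifold_holomorphic_P1 M \<A> g \<Longrightarrow> P1_disc (g \<circ> \<sigma>)"
        using N'(4)[OF k] by blast
      have "\<sigma> ` ball 0 1 \<subseteq> N" using \<sigma>(1) by (auto simp: continuous_map_in_subtopology)
      then show ?thesis using \<sigma> \<sigma>(4)[OF hol] by (auto simp: o_def)
    qed
    then show "\<exists>N'. openin M N' \<and> l \<in> N' \<and> N' \<subseteq> N \<and> (\<forall>k\<in>N'. \<exists>\<sigma>. \<sigma> ` ball 0 1 \<subseteq> N \<and> \<sigma> 0 = l \<and>
        \<sigma> (1/3) = k \<and> (\<forall>z. P1_disc (\<lambda>u. \<phi> (\<sigma> u) z)))"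
      using N' by blast
  qed
  then show 1: "continuous_map (prod_topology M P1) P1 (\<lambda>(l, z). \<phi> l z)"
    using hol holomorphic_qc_family_homeomorphic[OF \<phi>]
    by (intro motion_continuous) (auto simp: manifold_holomorphic_P1_def)
  show "continuous_map (prod_topology M P1) P1 (\<lambda>(l, w). inv (\<phi> l) w)"
    by (intro motion_inverse_continuous 1 holomorphic_qc_family_homeomorphic[OF \<phi>])
qed

lemma connected_space_locally_constant:
  assumes "connected_space M" "l0 \<in> topspace M" "l \<in> topspace M"
    and loc: "\<And>k. k \<in> topspace M \<Longrightarrow> \<exists>N. openin M N \<and> k \<in> N \<and> (\<forall>m\<in>N. F m = F k)"
  shows "F l = F l0"
proof -
  define T where "T = {k \<in> topspace M. F k = F l0}"
  have nbhd: "\<exists>N. openin M N \<and> k \<in> N \<and> (\<forall>m\<in>N. m \<in> T \<longleftrightarrow> k \<in> T)" if k: "k \<in> topspace M" for k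
  proof -
    obtain N where N: "openin M N" "k \<in> N" "\<forall>m\<in>N. F m = F k" using loc[OF k] by blast
    have "m \<in> T \<longleftrightarrow> k \<in> T" if "m \<in> N" for m
    proof -
      have "F m = F k" "m \<in> topspace M" using N that openin_subset[OF N(1)] by blast+
      then show ?thesis using k by (simp add: T_def)
    qed
    then show ?thesis using N by blast
  qed
  have TM: "T \<subseteq> topspace M" by (auto simp: T_def)
  have "openin M T"
  proof (subst openin_subopen, intro ballI)
    fix k assume k: "k \<in> T"
    obtain N where N: "openin M N \<and> k \<in> N \<and> (\<forall>m\<in>N. m \<in> T \<longleftrightarrow> k \<in> T)"
      using nbhd[OF subsetD[OF TM k]] by (rule exE)
    then have "N \<subseteq> T" using k by fast
    then show "\<exists>S. openin M S \<and> k \<in> S \<and> S \<subseteq> T" using N by blast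
  qed
  moreover have "openin M (topspace M - T)"
  proof (subst openin_subopen, intro ballI)
    fix k assume k: "k \<in> topspace M - T"
    obtain N where N: "openin M N \<and> k \<in> N \<and> (\<forall>m\<in>N. m \<in> T \<longleftrightarrow> k \<in> T)"
      using nbhd[OF DiffD1[OF k]] by (rule exE)
    then have "N \<inter> T = {}" using k by fast
    then show "\<exists>S. openin M S \<and> k \<in> S \<and> S \<subseteq> topspace M - T"
      using openin_subset[of M N] N by blast
  qed
  ultimately have "T = {} \<or> T = topspace M"
    using assms(1) unfolding connected_space_clopen_in by (auto simp: closedin_def T_def)
  then show ?thesis using assms(2,3) by (auto simp: T_def)
qed

section \<open>Critical values\<close>

text \<open>The negation of this property describes the critical points in topological terms; it includes
  the points near which \<open>f\<close> is constant.\<close>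

definition locally_injective_at :: "(complex option \<Rightarrow> complex option) \<Rightarrow> complex option set \<Rightarrow> complex option \<Rightarrow> bool" where
  "locally_injective_at f W z \<longleftrightarrow> (\<exists>G. openin P1 G \<and> z \<in> G \<and> G \<subseteq> W \<and> inj_on f G)"

lemma P1_holomorphic_in_charts:
  assumes f: "P1_holomorphic_on f W" and c: "(U, c) \<in> P1_charts" and d: "(V, d) \<in> P1_charts"
  shows "openin P1 {z \<in> U \<inter> W. f z \<in> V}" "open (c ` {z \<in> U \<inter> W. f z \<in> V})"
    "(d \<circ> f \<circ> inv_into U c) holomorphic_on c ` {z \<in> U \<inter> W. f z \<in> V}"
proof -
  have W: "openin P1 W" and cont: "continuous_map (subtopology P1 W) P1 f"
    using f by (auto simp: P1_holomorphic_on_def)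
  have "openin (subtopology P1 W) {z \<in> topspace (subtopology P1 W). f z \<in> V}"
    by (rule openin_continuous_map_preimage[OF cont homeomorphic_map_P1_chart(1)[OF d]])
  then have "openin P1 {z \<in> W. f z \<in> V}" using W by (simp add: openin_open_subtopology)
  then have "openin P1 (U \<inter> {z \<in> W. f z \<in> V})" using homeomorphic_map_P1_chart(1)[OF c] by (rule openin_Int[rotated])
  moreover have "U \<inter> {z \<in> W. f z \<in> V} = {z \<in> U \<inter> W. f z \<in> V}" by auto
  ultimately show "openin P1 {z \<in> U \<inter> W. f z \<in> V}" by simp
  then show "open (c ` {z \<in> U \<inter> W. f z \<in> V})" by (rule P1_chart_open_image[OF c]) auto
  show "(d \<circ> f \<circ> inv_into U c) holomorphic_on c ` {z \<in> U \<inter> W. f z \<in> V}"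
    using f c d unfolding P1_holomorphic_on_def by blast
qed

lemma deriv_eq_0_iff_not_locally_injective:
  assumes f: "P1_holomorphic_on f W" and c: "(U, c) \<in> P1_charts" and d: "(V, d) \<in> P1_charts"
    and z: "z \<in> W" "z \<in> U" "f z \<in> V"
  shows "deriv (d \<circ> f \<circ> inv_into U c) (c z) = 0 \<longleftrightarrow> \<not> locally_injective_at f W z"
proof -
  define K where "K = d \<circ> f \<circ> inv_into U c"
  define D where "D = {z \<in> U \<inter> W. f z \<in> V}"
  note hol = P1_holomorphic_in_charts[OF f c d, folded K_def D_def]
  have Kc: "K (c x) = d (f x)" if "x \<in> U" for x using that P1_chart_bij(3)[OF c] by (simp add: K_def)
  have zD: "z \<in> D" using z by (simp add: D_def)
  have "locally_injective_at f W z" if nz: "deriv K (c z) \<noteq> 0"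
  proof -
    obtain r where r: "r > 0" "ball (c z) r \<subseteq> c ` D" "inj_on K (ball (c z) r)"
      by (rule has_complex_derivative_locally_injective[OF hol(3) imageI[OF zD, of c] hol(2) nz])
    define G where "G = {x \<in> U. c x \<in> ball (c z) r}"
    have G_D: "x \<in> D" if "x \<in> G" for x
    proof -
      have "c x \<in> c ` D" using that r by (auto simp: G_def)
      then show ?thesis using that P1_chart_bij(1)[OF c] by (auto simp: G_def D_def inj_on_def)
    qed
    have "inj_on f G"
    proof (rule inj_onI)
      fix x y assume xy: "x \<in> G" "y \<in> G" "f x = f y"
      then have "K (c x) = K (c y)" by (simp add: Kc G_def)
      then have "c x = c y" using r(3) xy by (auto simp: G_def inj_on_def)
      then show "x = y" using P1_chart_bij(1)[OF c] xy by (auto simp: G_def inj_on_def)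
    qed
    moreover have "openin P1 G" unfolding G_def by (rule P1_chart_open_preimage[OF c]) auto
    moreover have "z \<in> G" using z r by (simp add: G_def)
    moreover have "G \<subseteq> W" using G_D by (auto simp: D_def)
    ultimately show ?thesis unfolding locally_injective_at_def by blast
  qed
  moreover have "deriv K (c z) \<noteq> 0" if li: "locally_injective_at f W z"
  proof -
    obtain G where G: "openin P1 G" "z \<in> G" "G \<subseteq> W" "inj_on f G"
      using li unfolding locally_injective_at_def by blast
    have GD: "openin P1 (G \<inter> D)" "G \<inter> D \<subseteq> U" using G hol(1) by (auto simp: D_def)
    have "inj_on K (c ` (G \<inter> D))"
    proof (rule inj_onI; clarify)
      fix x y assume xy: "x \<in> G" "x \<in> D" "y \<in> G" "y \<in> D" "K (c x) = K (c y)"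
      then have "d (f x) = d (f y)" by (simp add: Kc D_def)
      then have "f x = f y" using P1_chart_bij(1)[OF d] xy by (auto simp: D_def inj_on_def)
      then show "c x = c y" using G(4) xy by (auto simp: inj_on_def)
    qed
    moreover have "K holomorphic_on c ` (G \<inter> D)" by (rule holomorphic_on_subset[OF hol(3)]) auto
    ultimately show ?thesis
      using holomorphic_injective_imp_regular P1_chart_open_image[OF c GD] G(2) zD by blast
  qed
  ultimately show ?thesis unfolding K_def by blast
qed

lemma critical_value_not_locally_injective:
  assumes "P1_holomorphic_on f W" "v \<in> critical_values W f"
  obtains z where "z \<in> W" "v = f z" "\<not> locally_injective_at f W z"
proof -
  obtain z p q where z: "z \<in> W" "v = f z" and p: "p \<in> P1_charts" "q \<in> P1_charts"
    and d0: "case p of (U, c) \<Rightarrow> case q of (V, d) \<Rightarrow> z \<in> U \<and> f z \<in> V \<and>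
       deriv (d \<circ> f \<circ> inv_into U c) (c z) = 0"
    using assms(2) unfolding critical_values_def by blast
  obtain U c V d where pq: "p = (U, c)" "q = (V, d)" by (cases p, cases q)
  have "\<not> locally_injective_at f W z"
    using deriv_eq_0_iff_not_locally_injective[OF assms(1) p[unfolded pq] z(1)] d0 by (simp add: pq)
  with z show thesis by (rule that)
qed

text \<open>In charts, the zeros of the derivative are isolated, unless the derivative vanishes identically
  and \<open>f\<close> is constant near \<open>w\<close>. In both cases \<open>f\<close> takes a single value at the critical points near \<open>w\<close>.\<close>

lemma critical_values_isolated:
  assumes f: "P1_holomorphic_on f W" and w: "w \<in> W" "\<not> locally_injective_at f W w"
  shows "\<exists>G. openin P1 G \<and> w \<in> G \<and> G \<subseteq> W \<and> (\<forall>y\<in>G. \<not> locally_injective_at f W y \<longrightarrow> f y = f w)"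
proof -
  obtain U c where c: "(U, c) \<in> P1_charts" "w \<in> U" by (rule P1_chart_exists)
  obtain V d where d: "(V, d) \<in> P1_charts" "f w \<in> V" by (rule P1_chart_exists)
  define K where "K = d \<circ> f \<circ> inv_into U c"
  define D where "D = {z \<in> U \<inter> W. f z \<in> V}"
  note hol = P1_holomorphic_in_charts[OF f c(1) d(1), folded K_def D_def]
  have crit: "deriv K (c x) = 0 \<longleftrightarrow> \<not> locally_injective_at f W x" if "x \<in> D" for x
    using deriv_eq_0_iff_not_locally_injective[OF f c(1) d(1), of x] that by (simp add: K_def D_def)
  have Kc: "K (c x) = d (f x)" if "x \<in> U" for x using that P1_chart_bij(3)[OF c(1)] by (simp add: K_def)
  have wD: "w \<in> D" using c d w by (simp add: D_def)
  obtain r where r: "r > 0" "ball (c w) r \<subseteq> c ` D" using hol(2) wD open_contains_ball by (metis imageI)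
  have nbhd: "openin P1 {x \<in> U. c x \<in> ball (c w) s}" "w \<in> {x \<in> U. c x \<in> ball (c w) s}"
      "{x \<in> U. c x \<in> ball (c w) s} \<subseteq> D" if "0 < s" "s \<le> r" for s
  proof -
    show "openin P1 {x \<in> U. c x \<in> ball (c w) s}" by (rule P1_chart_open_preimage[OF c(1)]) auto
    show "w \<in> {x \<in> U. c x \<in> ball (c w) s}" using c that by simp
    show "{x \<in> U. c x \<in> ball (c w) s} \<subseteq> D"
    proof
      fix x assume x: "x \<in> {x \<in> U. c x \<in> ball (c w) s}"
      then have "c x \<in> c ` D" using r that by auto
      then show "x \<in> D" using x P1_chart_bij(1)[OF c(1)] by (auto simp: D_def inj_on_def)
    qed
  qed
  have holK: "K holomorphic_on ball (c w) r" using hol(3) r(2) by (rule holomorphic_on_subset)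
  show ?thesis
  proof (cases "\<forall>\<beta>\<in>ball (c w) r. deriv K \<beta> = 0")
    case True
    then have "K constant_on ball (c w) r"
      by (intro has_field_derivative_0_imp_constant_on[of "ball (c w) r" K])
         (use holK holomorphic_derivI in force)+
    then have const: "K x = K (c w)" if "x \<in> ball (c w) r" for x
      using that r unfolding constant_on_def by (metis centre_in_ball)
    have const_f: "f x = f w" if x: "x \<in> {x \<in> U. c x \<in> ball (c w) r}" for x
    proof -
      have "K (c x) = K (c w)" using x by (intro const) auto
      then have "d (f x) = d (f w)" using Kc x c by auto
      moreover have "x \<in> D" using nbhd(3)[OF r(1) order_refl] x by blast
      ultimately show ?thesis using P1_chart_bij(1)[OF d(1)] d(2) by (auto simp: D_def inj_on_def)
    qed
    have "{x \<in> U. c x \<in> ball (c w) r} \<subseteq> W" using nbhd(3)[OF r(1) order_refl] by (auto simp: D_def)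
    then show ?thesis using nbhd(1,2)[OF r(1) order_refl] const_f
      by (intro exI[of _ "{x \<in> U. c x \<in> ball (c w) r}"] conjI ballI impI)
  next
    case False
    then obtain \<beta> where \<beta>: "\<beta> \<in> ball (c w) r" "deriv K \<beta> \<noteq> 0" by blast
    have "deriv K (c w) = 0" using crit[OF wD] w by blast
    moreover have "deriv K holomorphic_on ball (c w) r" using holK by (rule holomorphic_deriv) auto
    ultimately obtain s where s: "0 < s" "ball (c w) s \<subseteq> ball (c w) r"
        "\<And>x. x \<in> ball (c w) s - {c w} \<Longrightarrow> deriv K x \<noteq> 0"
      using isolated_zeros[of "deriv K" "ball (c w) r" "c w" \<beta>] \<beta> r(1) by (metis (full_types) centre_in_ball connected_ball open_ball)
    have "s \<le> r" using s(1,2) r(1) by (simp add: ball_subset_ball_iff)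
    have const_f: "f y = f w" if y: "y \<in> {x \<in> U. c x \<in> ball (c w) s}" "\<not> locally_injective_at f W y" for y
    proof -
      have "y \<in> D" using nbhd(3)[OF s(1) \<open>s \<le> r\<close>] y by blast
      then have "c y = c w" using crit y s(3)[of "c y"] by auto
      then show ?thesis using y c P1_chart_bij(1)[OF c(1)] by (auto simp: inj_on_def)
    qed
    have "{x \<in> U. c x \<in> ball (c w) s} \<subseteq> W" using nbhd(3)[OF s(1) \<open>s \<le> r\<close>] by (auto simp: D_def)
    then show ?thesis using nbhd(1,2)[OF s(1) \<open>s \<le> r\<close>] const_f
      by (intro exI[of _ "{x \<in> U. c x \<in> ball (c w) s}"] conjI ballI impI)
  qed
qed

lemma locally_injective_transfer:
  assumes h: "homeomorphic_map P1 P1 h" "h ` W = W" and g: "inj g"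
    and eq: "\<And>z. z \<in> W \<Longrightarrow> g (f z) = f (h z)"
    and z: "z \<in> W" "locally_injective_at f W (h z)"
  shows "locally_injective_at f W z"
proof -
  obtain G where G: "openin P1 G" "h z \<in> G" "G \<subseteq> W" "inj_on f G"
    using z(2) unfolding locally_injective_at_def by blast
  have inj: "inj h" using homeomorphic_imp_injective_map[OF h(1)] by simp
  define G' where "G' = {x \<in> topspace P1. h x \<in> G}"
  have "openin P1 G'" unfolding G'_def
    by (rule openin_continuous_map_preimage[OF homeomorphic_imp_continuous_map[OF h(1)] G(1)])
  moreover have sub: "G' \<subseteq> W"
  proof
    fix x assume "x \<in> G'"
    then have "h x \<in> h ` W" using G(3) h(2) by (auto simp: G'_def)
    then show "x \<in> W" using inj by (auto simp: inj_def)
  qed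
  moreover have "inj_on f G'"
  proof (rule inj_onI)
    fix x y assume xy: "x \<in> G'" "y \<in> G'" "f x = f y"
    have "f (h x) = g (f x)" "f (h y) = g (f y)"
      using eq[of x] eq[of y] sub xy(1,2) by auto
    then have "f (h x) = f (h y)" using xy(3) by simp
    then show "x = y" using G(4) xy inj by (auto simp: G'_def inj_on_def inj_def)
  qed
  ultimately show ?thesis using G(2) unfolding locally_injective_at_def
    by (intro exI[of _ G']) (auto simp: G'_def)
qed

text \<open>If \<open>z\<close> is critical then so is \<open>h l z\<close> for all \<open>l\<close>, and it moves continuously. Hence
  \<open>g l (f z) = f (h l z)\<close> is locally constant in \<open>l\<close>, with the value \<open>f z\<close> at \<open>l0\<close>.\<close>

lemma critical_value_fixed:
  fixes g h :: "'m \<Rightarrow> complex option \<Rightarrow> complex option"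
  assumes f: "P1_holomorphic_on f W" and M: "connected_space M" "l0 \<in> topspace M"
    and h: "continuous_map (prod_topology M P1) P1 (\<lambda>(l, z). h l z)"
    and hom: "\<And>l. l \<in> topspace M \<Longrightarrow> homeomorphic_map P1 P1 (h l)" "\<And>l. l \<in> topspace M \<Longrightarrow> h l ` W = W"
    and g: "\<And>l. l \<in> topspace M \<Longrightarrow> inj (g l)" "g l0 = id"
    and eq: "\<And>l z. l \<in> topspace M \<Longrightarrow> z \<in> W \<Longrightarrow> g l (f z) = f (h l z)"
    and v: "v \<in> critical_values W f" and l: "l \<in> topspace M"
  shows "g l v = v"
proof -
  obtain z where z: "z \<in> W" "v = f z" "\<not> locally_injective_at f W z"
    using critical_value_not_locally_injective[OF f v] .
  have hz: "continuous_map M P1 (\<lambda>l. h l z)"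
    using continuous_map_compose[OF _ h, of M "\<lambda>l. (l, z)"] by (simp add: o_def continuous_map_pairedI)
  have crit: "\<not> locally_injective_at f W (h k z)" and hW: "h k z \<in> W" if k: "k \<in> topspace M" for k
    using locally_injective_transfer[of "h k" W "g k" f z, OF hom[OF k] g(1)[OF k] eq[OF k] z(1)]
      z(1,3) hom(2)[OF k] by auto
  have "f (h l z) = f (h l0 z)"
  proof (rule connected_space_locally_constant[OF M l])
    fix k assume k: "k \<in> topspace M"
    obtain G where G: "openin P1 G" "h k z \<in> G" "\<forall>y\<in>G. \<not> locally_injective_at f W y \<longrightarrow> f y = f (h k z)"
      using critical_values_isolated[OF f hW[OF k] crit[OF k]] by blast
    define N where "N = {m \<in> topspace M. h m z \<in> G}"
    have "openin M N" unfolding N_def by (rule openin_continuous_map_preimage[OF hz G(1)])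
    moreover have "k \<in> N" using k G(2) by (simp add: N_def)
    moreover have "f (h m z) = f (h k z)" if "m \<in> N" for m
      using G(3) crit[of m] that unfolding N_def by blast
    ultimately show "\<exists>N. openin M N \<and> k \<in> N \<and> (\<forall>m\<in>N. f (h m z) = f (h k z))" by blast
  qed
  then show ?thesis using eq[OF l z(1)] eq[OF M(2) z(1)] g(2) z(2) by simp
qed

section \<open>Asymptotic values\<close>

lemma limitin_P1_chart:
  assumes c: "(V, d) \<in> P1_charts" and x: "x \<in> V" and lim: "limitin P1 X x F"
  shows "((\<lambda>t. d (X t)) \<longlongrightarrow> d x) F"
proof (rule topological_tendstoI)
  fix B assume B: "open B" "d x \<in> B"
  have "openin P1 {y \<in> V. d y \<in> B}" by (rule P1_chart_open_preimage[OF c B(1)])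
  then have "\<forall>\<^sub>F t in F. X t \<in> {y \<in> V. d y \<in> B}"
    using lim x B(2) unfolding limitin_def by blast
  then show "\<forall>\<^sub>F t in F. d (X t) \<in> B" by eventually_elim auto
qed

text \<open>The set \<open>\<omega>\<close> of cluster points of the curve is non-empty by compactness, contained in \<open>K\<close>, and
  connected because the tails of the curve are connected. So it is a single point.\<close>

lemma curve_to_totally_disconnected_converges:
  fixes \<gamma> :: "real \<Rightarrow> 'a"
  assumes X: "compact_space X" "Hausdorff_space X"
    and \<gamma>: "continuous_map (top_of_set {0..}) X \<gamma>"
    and K: "closedin X K" "totally_disconnected_in X K"
    and near: "\<And>G. openin X G \<Longrightarrow> K \<subseteq> G \<Longrightarrow> \<forall>\<^sub>F t in at_top. \<gamma> t \<in> G"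
  obtains x where "x \<in> K" "limitin X \<gamma> x at_top"
proof -
  define \<omega> where "\<omega> = {x \<in> topspace X. \<forall>G. openin X G \<and> x \<in> G \<longrightarrow> (\<exists>\<^sub>F t in at_top. \<gamma> t \<in> G)}"
  have out: "\<exists>G. openin X G \<and> x \<in> G \<and> (\<forall>\<^sub>F t in at_top. \<gamma> t \<notin> G)" if "x \<in> topspace X - \<omega>" for x
    using that unfolding \<omega>_def by (auto simp: not_frequently)
  have "openin X (topspace X - \<omega>)"
  proof (subst openin_subopen, intro ballI)
    fix x assume "x \<in> topspace X - \<omega>"
    then obtain G where G: "openin X G" "x \<in> G" "\<forall>\<^sub>F t in at_top. \<gamma> t \<notin> G" using out by blast
    then have "G \<inter> \<omega> = {}" by (auto simp: \<omega>_def frequently_def)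
    then show "\<exists>T. openin X T \<and> x \<in> T \<and> T \<subseteq> topspace X - \<omega>" using G openin_subset[OF G(1)] by blast
  qed
  moreover have \<omega>X: "\<omega> \<subseteq> topspace X" by (auto simp: \<omega>_def)
  ultimately have cl: "closedin X \<omega>" by (simp add: closedin_def)
  have attract: "\<forall>\<^sub>F t in at_top. \<gamma> t \<in> G" if G: "openin X G" "\<omega> \<subseteq> G" for G
  proof -
    have "compactin X (topspace X - G)"
      using G X by (intro closedin_compact_space closedin_diff closedin_topspace)
    define \<U> where "\<U> = {B. openin X B \<and> (\<forall>\<^sub>F t in at_top. \<gamma> t \<notin> B)}"
    have "topspace X - G \<subseteq> \<Union>\<U>" using out G(2) by (fastforce simp: \<U>_def)
    then obtain \<F> where \<F>: "finite \<F>" "\<F> \<subseteq> \<U>" "topspace X - G \<subseteq> \<Union>\<F>"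
      using \<open>compactin X (topspace X - G)\<close> unfolding compactin_def by (metis (no_types, lifting) \<U>_def mem_Collect_eq)
    have "\<forall>\<^sub>F t in at_top. \<forall>B\<in>\<F>. \<gamma> t \<notin> B"
      using \<F>(1,2) by (intro eventually_ball_finite) (auto simp: \<U>_def)
    moreover have "\<forall>\<^sub>F t in at_top. \<gamma> t \<in> topspace X"
      using eventually_ge_at_top[of 0] by eventually_elim (use \<gamma> in \<open>auto simp: continuous_map_def\<close>)
    ultimately show ?thesis by eventually_elim (use \<F>(3) in blast)
  qed
  have "\<omega> \<subseteq> K"
  proof
    fix x assume x: "x \<in> \<omega>"
    show "x \<in> K"
    proof (rule ccontr)
      assume "x \<notin> K"
      then obtain A B where AB: "openin X A" "openin X B" "{x} \<subseteq> A" "K \<subseteq> B" "disjnt A B"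
        using Hausdorff_space_compact_separation[OF X(2), of "{x}" K] K(1) X(1) x \<omega>X
        by (metis closedin_compact_space compactin_sing disjnt_insert1 disjnt_empty1 subsetD)
      have "\<exists>\<^sub>F t in at_top. \<gamma> t \<in> A" using x AB by (auto simp: \<omega>_def)
      moreover have "\<forall>\<^sub>F t in at_top. \<gamma> t \<in> B" by (rule near) (use AB in auto)
      then have "\<forall>\<^sub>F t in at_top. \<gamma> t \<notin> A" by eventually_elim (use AB(5) in \<open>auto simp: disjnt_def\<close>)
      ultimately show False by (simp add: frequently_def)
    qed
  qed
  moreover have "connectedin X \<omega>"
    unfolding connectedin_closedin
  proof (intro conjI notI \<omega>X, elim exE conjE)
    fix E1 E2
    assume E: "closedin X E1" "closedin X E2" "\<omega> \<subseteq> E1 \<union> E2" "E1 \<inter> E2 \<inter> \<omega> = {}" "E1 \<inter> \<omega> \<noteq> {}" "E2 \<inter> \<omega> \<noteq> {}"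
    have "compactin X (E1 \<inter> \<omega>)" "compactin X (E2 \<inter> \<omega>)"
      using E cl X(1) by (auto intro: closedin_compact_space)
    moreover have "disjnt (E1 \<inter> \<omega>) (E2 \<inter> \<omega>)" using E(4) by (auto simp: disjnt_def)
    ultimately obtain A B where AB: "openin X A" "openin X B" "E1 \<inter> \<omega> \<subseteq> A" "E2 \<inter> \<omega> \<subseteq> B" "disjnt A B"
      by (rule Hausdorff_space_compact_separation[OF X(2)])
    have "\<forall>\<^sub>F t in at_top. \<gamma> t \<in> A \<union> B" by (rule attract) (use AB E in auto)
    then obtain T where T: "\<And>t. t \<ge> T \<Longrightarrow> \<gamma> t \<in> A \<union> B" unfolding eventually_at_top_linorder by blast
    define I where "I = {max T 0..}"
    have "connectedin X (\<gamma> ` I)"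
      by (rule connectedin_continuous_map_image[OF \<gamma>])
         (auto simp: I_def connectedin_subtopology)
    moreover have "\<gamma> ` I \<subseteq> A \<union> B"
    proof (rule image_subsetI)
      fix t assume "t \<in> I"
      then show "\<gamma> t \<in> A \<union> B" by (intro T) (simp add: I_def)
    qed
    moreover have "A \<inter> B \<inter> \<gamma> ` I = {}" using AB(5) by (auto simp: disjnt_def)
    ultimately have "A \<inter> \<gamma> ` I = {} \<or> B \<inter> \<gamma> ` I = {}" using AB(1,2) unfolding connectedin by blast
    moreover have "\<exists>\<^sub>F t in at_top. \<gamma> t \<in> A" "\<exists>\<^sub>F t in at_top. \<gamma> t \<in> B"
      using E(5,6) AB by (auto simp: \<omega>_def)
    moreover have ev: "\<forall>\<^sub>F t in at_top. t \<in> I"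
      using eventually_ge_at_top[of "max T 0"] by (simp add: I_def)
    ultimately show False
    proof (elim disjE)
      assume "A \<inter> \<gamma> ` I = {}"
      then have "\<And>t. t \<in> I \<Longrightarrow> \<gamma> t \<notin> A" by blast
      then have "\<forall>\<^sub>F t in at_top. \<gamma> t \<notin> A" by (rule eventually_mono[OF ev])
      then show False using \<open>\<exists>\<^sub>F t in at_top. \<gamma> t \<in> A\<close> by (simp add: frequently_def)
    next
      assume "B \<inter> \<gamma> ` I = {}"
      then have "\<And>t. t \<in> I \<Longrightarrow> \<gamma> t \<notin> B" by blast
      then have "\<forall>\<^sub>F t in at_top. \<gamma> t \<notin> B" by (rule eventually_mono[OF ev])
      then show False using \<open>\<exists>\<^sub>F t in at_top. \<gamma> t \<in> B\<close> by (simp add: frequently_def)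
    qed
  qed
  ultimately obtain a where a: "\<omega> \<subseteq> {a}" using K(2) unfolding totally_disconnected_in_def by blast
  have "\<omega> \<noteq> {}"
  proof
    assume "\<omega> = {}"
    then have "\<forall>\<^sub>F t in at_top. \<gamma> t \<in> {}" by (intro attract) auto
    then show False by simp
  qed
  then have "\<omega> = {a}" using a by blast
  then have "a \<in> K" "limitin X \<gamma> a at_top"
    using \<open>\<omega> \<subseteq> K\<close> \<omega>X attract by (auto simp: limitin_def)
  then show thesis by (rule that)
qed

lemma openin_joint_preimage:
  assumes "continuous_map (prod_topology M P1) P1 (\<lambda>(l, z). h l z)" "openin P1 G"
  shows "openin (prod_topology M P1) {p \<in> topspace (prod_topology M P1). h (fst p) (snd p) \<in> G}"
  using openin_continuous_map_preimage[OF assms] by (simp add: case_prod_unfold)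

lemma joint_neighbourhoods:
  assumes h: "continuous_map (prod_topology M P1) P1 (\<lambda>(l, z). h l z)" and G: "openin P1 G"
    and l: "l \<in> topspace M" and hG: "h l z \<in> G"
  obtains N Z where "openin M N" "openin P1 Z" "l \<in> N" "z \<in> Z" "\<And>m w. m \<in> N \<Longrightarrow> w \<in> Z \<Longrightarrow> h m w \<in> G"
proof -
  have lz: "(l, z) \<in> {p \<in> topspace (prod_topology M P1). h (fst p) (snd p) \<in> G}" using l hG by simp
  obtain N Z where NZ: "openin M N" "openin P1 Z" "l \<in> N" "z \<in> Z"
      "N \<times> Z \<subseteq> {p \<in> topspace (prod_topology M P1). h (fst p) (snd p) \<in> G}"
    using openin_joint_preimage[OF h G, unfolded openin_prod_topology_alt, rule_format, OF lz]
    by (elim exE conjE)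
  have "h m w \<in> G" if "m \<in> N" "w \<in> Z" for m w
  proof -
    have "(m, w) \<in> N \<times> Z" using that by simp
    then have "(m, w) \<in> {p \<in> topspace (prod_topology M P1). h (fst p) (snd p) \<in> G}" using NZ(5) by blast
    then show ?thesis by simp
  qed
  with NZ(1-4) show thesis by (rule that)
qed

text \<open>For \<open>m\<close> near \<open>k\<close> let \<open>\<sigma>\<close> be a disc in \<open>M\<close> with \<open>\<sigma> 0 = k\<close> and \<open>\<sigma> (1/3) = m\<close>. The homotopy to which
  \<open>lindelof_two_limits_homotopic\<close> is applied is \<open>h (\<sigma> (s/3)) (\<gamma> (T + t))\<close> for \<open>t \<ge> 0\<close> and \<open>0 \<le> s \<le> 1\<close>, in
  a chart around the common end point \<open>x'\<close> of all the curves \<open>h l \<circ> \<gamma>\<close>. The function is \<open>f\<close>, in a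
  chart around \<open>g k v\<close>.\<close>

lemma asymptotic_value_fixed:
  fixes g h :: "'m \<Rightarrow> complex option \<Rightarrow> complex option" and \<A> :: "('m set \<times> ('m \<Rightarrow> complex ^ 'n)) set"
  assumes M: "complex_manifold M \<A>" "connected_space M" "l0 \<in> topspace M"
    and f: "P1_holomorphic_on f W" and td: "totally_disconnected_in P1 (P1 frontier_of W)"
    and h: "continuous_map (prod_topology M P1) P1 (\<lambda>(l, z). h l z)"
    and g: "continuous_map (prod_topology M P1) P1 (\<lambda>(l, z). g l z)"
    and hom: "\<And>l. l \<in> topspace M \<Longrightarrow> homeomorphic_map P1 P1 (h l)" "\<And>l. l \<in> topspace M \<Longrightarrow> h l ` W = W"
    and g0: "g l0 = id"
    and eq: "\<And>l z. l \<in> topspace M \<Longrightarrow> z \<in> W \<Longrightarrow> g l (f z) = f (h l z)"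
    and v: "v \<in> asymptotic_values W f" and l: "l \<in> topspace M"
  shows "g l v = v"
proof -
  obtain \<gamma> :: "real \<Rightarrow> complex option" where
    \<gamma>': "continuous_map (top_of_set {0..}) (subtopology P1 W) \<gamma> \<and>
        (\<forall>G. openin P1 G \<and> P1 frontier_of W \<subseteq> G \<longrightarrow> (\<forall>\<^sub>F t in at_top. \<gamma> t \<in> G)) \<and>
        limitin P1 (f \<circ> \<gamma>) v at_top"
    using v unfolding asymptotic_values_def mem_Collect_eq by (rule exE)
  then have \<gamma>W: "continuous_map (top_of_set {0..}) (subtopology P1 W) \<gamma>"
    and near: "\<And>G. openin P1 G \<Longrightarrow> P1 frontier_of W \<subseteq> G \<Longrightarrow> \<forall>\<^sub>F t in at_top. \<gamma> t \<in> G"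
    and lim_v: "limitin P1 (f \<circ> \<gamma>) v at_top"
    by simp_all
  have \<gamma>: "continuous_map (top_of_set {0..}) P1 \<gamma>" and \<gamma>_in: "\<And>t. t \<ge> 0 \<Longrightarrow> \<gamma> t \<in> W"
    using \<gamma>W by (auto simp: continuous_map_in_subtopology)
  obtain x where x: "x \<in> P1 frontier_of W" "limitin P1 \<gamma> x at_top"
    using curve_to_totally_disconnected_converges[OF compact_space_Alexandroff_compactification
        Hausdorff_space_P1 \<gamma> closedin_frontier_of td near] by blast
  have W: "openin P1 W" using f by (simp add: P1_holomorphic_on_def)
  have h_slice: "continuous_map M P1 (\<lambda>l. h l z)" for z
    using continuous_map_compose[OF _ h, of M "\<lambda>l. (l, z)"] by (simp add: o_def continuous_map_pairedI)
  have frW: "h k ` (P1 frontier_of W) = P1 frontier_of W" if "k \<in> topspace M" for k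
    using homeomorphic_map_frontier_of[OF hom(1)[OF that], of W] hom(2)[OF that] by simp
  define E where "E = (\<lambda>l. h l x) ` topspace M"
  have "connectedin P1 E" unfolding E_def
    by (rule connectedin_continuous_map_image[OF h_slice]) (use M(2) in \<open>simp add: connectedin_topspace\<close>)
  moreover have "E \<subseteq> P1 frontier_of W" using frW x(1) unfolding E_def by blast
  ultimately obtain x' where x': "E \<subseteq> {x'}" using td unfolding totally_disconnected_in_def by blast
  have hx: "h k x = x'" if "k \<in> topspace M" for k using x' that by (auto simp: E_def)
  have x'_fr: "x' \<in> P1 frontier_of W" using hx[OF l] frW[OF l] x(1) by blast
  have x'_W: "x' \<notin> W" using x'_fr W by (simp add: frontier_of_openin)
  obtain U c where c: "(U, c) \<in> P1_charts" "x' \<in> U" by (rule P1_chart_exists)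
  have "g l v = g l0 v"
  proof (rule connected_space_locally_constant[OF M(2,3) l])
    fix k assume k: "k \<in> topspace M"
    obtain V d where d: "(V, d) \<in> P1_charts" "g k v \<in> V" by (rule P1_chart_exists)
    define B where "B = {y \<in> V. d y \<in> ball (d (g k v)) 1}"
    have B: "openin P1 B" "g k v \<in> B" "B \<subseteq> V"
      unfolding B_def using d by (simp_all only: P1_chart_open_preimage[OF d(1) open_ball]) auto
    obtain N1 O1 where N1: "openin M N1" "openin P1 O1" "k \<in> N1" "v \<in> O1"
        "\<And>m w. m \<in> N1 \<Longrightarrow> w \<in> O1 \<Longrightarrow> g m w \<in> B"
      by (rule joint_neighbourhoods[OF g B(1) k B(2)]) blast
    have oU: "openin P1 U" by (rule homeomorphic_map_P1_chart(1)[OF c(1)])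
    have hU: "h k x \<in> U" using c(2) hx[OF k] by simp
    obtain N2 O2 where N2: "openin M N2" "openin P1 O2" "k \<in> N2" "x \<in> O2"
        "\<And>m w. m \<in> N2 \<Longrightarrow> w \<in> O2 \<Longrightarrow> h m w \<in> U"
      by (rule joint_neighbourhoods[OF h oU k hU]) blast
    have "\<forall>\<^sub>F t in at_top. \<gamma> t \<in> O2" using x(2) N2(2,4) by (simp add: limitin_def)
    moreover have "\<forall>\<^sub>F t in at_top. f (\<gamma> t) \<in> O1" using lim_v N1(2,4) by (simp add: limitin_def o_def)
    ultimately have "\<forall>\<^sub>F t in at_top. \<gamma> t \<in> O2 \<and> f (\<gamma> t) \<in> O1 \<and> t \<ge> 0"
      using eventually_ge_at_top[of 0] by eventually_elim simp
    then obtain T where T0: "\<And>t. t \<ge> T \<Longrightarrow> \<gamma> t \<in> O2 \<and> f (\<gamma> t) \<in> O1 \<and> t \<ge> 0"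
      unfolding eventually_at_top_linorder by blast
    then have T: "T \<ge> 0" by blast
    obtain N where N0: "openin M N \<and> k \<in> N \<and> N \<subseteq> N1 \<inter> N2 \<and>
       (\<forall>m\<in>N. \<exists>\<sigma>. continuous_map (top_of_set (ball 0 1)) (subtopology M (N1 \<inter> N2)) \<sigma> \<and>
         \<sigma> 0 = k \<and> \<sigma> (1/3) = m \<and> (\<forall>g. manifold_holomorphic_P1 M \<A> g \<longrightarrow> P1_disc (g \<circ> \<sigma>)))"
      using complex_manifold_disc[OF M(1) k openin_Int[OF N1(1) N2(1)] IntI[OF N1(3) N2(3)]] by (rule exE)
    then have N: "openin M N" "k \<in> N" "N \<subseteq> N1 \<inter> N2" by simp_all
    have "g m v = g k v" if m: "m \<in> N" for m
    proof -
      obtain \<sigma> :: "complex \<Rightarrow> 'm" where \<sigma>: "continuous_map (top_of_set (ball 0 1)) (subtopology M (N1 \<inter> N2)) \<sigma>"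
         "\<sigma> 0 = k" "\<sigma> (1/3) = m"
        using N0 m by blast
      define S :: "complex set" where "S = {z. 0 \<le> Re z \<and> 0 \<le> Im z \<and> Im z \<le> 1}"
      define \<alpha> where "\<alpha> = (\<lambda>z. complex_of_real (Im z / 3))"
      have \<alpha>: "\<alpha> z \<in> ball 0 1" if "z \<in> S" for z using that by (simp add: \<alpha>_def S_def)
      have \<sigma>M: "continuous_map (top_of_set (ball 0 1)) M \<sigma>" and \<sigma>N: "\<And>u. u \<in> ball 0 1 \<Longrightarrow> \<sigma> u \<in> N1 \<inter> N2"
        using \<sigma>(1) by (auto simp: continuous_map_in_subtopology)
      have NM: "\<sigma> u \<in> topspace M" if "u \<in> ball 0 1" for u
        using \<sigma>N[OF that] openin_subset[OF N1(1)] by blast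
      define P where "P z = h (\<sigma> (\<alpha> z)) (\<gamma> (T + Re z))" for z
      have PU: "P z \<in> U" if "z \<in> S" for z
        using N2(5) \<sigma>N[OF \<alpha>[OF that]] T0[of "T + Re z"] that by (auto simp: P_def S_def)
      have PW: "P z \<in> W" if z: "z \<in> S" for z
        using hom(2)[OF NM[OF \<alpha>[OF z]]] \<gamma>_in[of "T + Re z"] T z by (auto simp: P_def S_def)
      have fP: "f (P z) = g (\<sigma> (\<alpha> z)) (f (\<gamma> (T + Re z)))" if z: "z \<in> S" for z
        using eq[OF NM[OF \<alpha>[OF z]], of "\<gamma> (T + Re z)"] \<gamma>_in[of "T + Re z"] T z by (simp add: P_def S_def)
      have fPB: "f (P z) \<in> B" if z: "z \<in> S" for z
        unfolding fP[OF z] using N1(5) \<sigma>N[OF \<alpha>[OF z]] T0[of "T + Re z"] z by (simp add: S_def)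
      have contP: "continuous_map (top_of_set S) (subtopology P1 U) P"
      proof -
        have "continuous_map (top_of_set S) (top_of_set (ball 0 1)) \<alpha>"
          using \<alpha> by (auto simp: continuous_map_in_subtopology \<alpha>_def intro!: continuous_intros)
        then have 1: "continuous_map (top_of_set S) M (\<sigma> \<circ> \<alpha>)" using \<sigma>M by (rule continuous_map_compose)
        have "continuous_map (top_of_set S) (top_of_set {0..}) (\<lambda>z. T + Re z)"
          using T by (auto simp: continuous_map_in_subtopology S_def intro!: continuous_intros)
        then have 2: "continuous_map (top_of_set S) P1 (\<gamma> \<circ> (\<lambda>z. T + Re z))" using \<gamma> by (rule continuous_map_compose)
        have "continuous_map (top_of_set S) P1 ((\<lambda>(l, z). h l z) \<circ> (\<lambda>z. ((\<sigma> \<circ> \<alpha>) z, (\<gamma> \<circ> (\<lambda>z. T + Re z)) z)))"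
          by (rule continuous_map_compose[OF continuous_map_pairedI[OF 1 2] h])
        then have "continuous_map (top_of_set S) P1 P" by (simp add: o_def P_def[abs_def])
        then show ?thesis using PU by (auto simp: continuous_map_in_subtopology)
      qed
      define H where "H z = c (P z) - c x'" for z
      have "continuous_map (top_of_set S) euclidean (c \<circ> P)"
        by (rule continuous_map_compose[OF contP homeomorphic_imp_continuous_map[OF homeomorphic_map_P1_chart(2)[OF c(1)]]])
      then have contH: "continuous_on S H"
        unfolding H_def by (intro continuous_intros) (simp add: o_def)
      define D where "D = {z \<in> U \<inter> W. f z \<in> V}"
      define K where "K = d \<circ> f \<circ> inv_into U c"
      note hol = P1_holomorphic_in_charts[OF f c(1) d(1), folded D_def K_def]
      have Kc: "K (c y) = d (f y)" if "y \<in> U" for y using that P1_chart_bij(3)[OF c(1)] by (simp add: K_def)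
      define R where "R = {w. w + c x' \<in> c ` D \<and> K (w + c x') \<in> ball (d (g k v)) 1}"
      define F where "F w = K (w + c x')" for w
      have openR: "open R"
      proof -
        have "open (c ` D \<inter> K -` ball (d (g k v)) 1)"
          by (intro continuous_open_preimage holomorphic_on_imp_continuous_on hol) auto
        then have "open ((\<lambda>w. w + c x') -` (c ` D \<inter> K -` ball (d (g k v)) 1))"
          by (intro open_vimage continuous_intros)
        then show ?thesis by (simp add: R_def vimage_def)
      qed
      have HR: "H ` S \<subseteq> R"
      proof
        fix w assume "w \<in> H ` S"
        then obtain z where z: "z \<in> S" "w = H z" by blast
        have "P z \<in> D" using PU[OF z(1)] PW[OF z(1)] fPB[OF z(1)] B(3) by (auto simp: D_def)
        moreover have "K (c (P z)) \<in> ball (d (g k v)) 1"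
          unfolding Kc[OF PU[OF z(1)]] using fPB[OF z(1)] by (simp add: B_def)
        ultimately show "w \<in> R" using z(2) by (auto simp: R_def H_def)
      qed
      have zeroR: "0 \<notin> R"
      proof
        assume "0 \<in> R"
        then obtain y where "y \<in> D" "c x' = c y" by (auto simp: R_def)
        then have "x' = y" using c(2) P1_chart_bij(1)[OF c(1)] by (auto simp: D_def inj_on_def)
        then show False using \<open>y \<in> D\<close> x'_W by (simp add: D_def)
      qed
      have holF: "F holomorphic_on R"
      proof -
        have "K \<circ> (\<lambda>w. w + c x') holomorphic_on R"
          by (rule holomorphic_on_compose_gen[OF _ hol(3)]) (auto simp: R_def intro!: holomorphic_intros)
        then show ?thesis by (simp add: F_def[abs_def] o_def)
      qed
      have bdF: "norm (F w) \<le> norm (d (g k v)) + 1" if "w \<in> R" for w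
        using that norm_triangle_ineq2[of "F w" "d (g k v)"]
        by (auto simp: R_def F_def dist_norm norm_minus_commute)
      \<comment> \<open>Each curve \<open>h l \<circ> \<gamma>\<close> ends at \<open>x'\<close>; compactness of the parameter interval makes this uniform.\<close>
      have H0: "\<exists>T'. \<forall>z\<in>S. T' \<le> Re z \<longrightarrow> norm (H z) < \<epsilon>" if \<epsilon>: "\<epsilon> > 0" for \<epsilon>
      proof -
        define Q where "Q = {y \<in> U. c y \<in> ball (c x') \<epsilon>}"
        have Q: "openin P1 Q" "x' \<in> Q" 
          unfolding Q_def using c(2) \<epsilon> by (simp_all only: P1_chart_open_preimage[OF c(1) open_ball]) auto
        define C where "C = \<sigma> ` complex_of_real ` {0..1/3}"
        have in_ball: "complex_of_real ` {0..1/3} \<subseteq> ball 0 1" by auto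
        have "compact (complex_of_real ` {0..1/3})" by (intro compact_continuous_image continuous_intros) auto
        then have "compactin M C" unfolding C_def
          using in_ball by (intro image_compactin[OF _ \<sigma>M]) (simp add: compactin_subtopology)
        moreover have "C \<times> {x} \<subseteq> {p \<in> topspace (prod_topology M P1). h (fst p) (snd p) \<in> Q}"
        proof (rule subsetI)
          fix p assume "p \<in> C \<times> {x}"
          then obtain u where u: "u \<in> ball 0 1" "p = (\<sigma> u, x)" using in_ball unfolding C_def by blast
          then show "p \<in> {p \<in> topspace (prod_topology M P1). h (fst p) (snd p) \<in> Q}"
            using NM[OF u(1)] hx[OF NM[OF u(1)]] Q(2) by simp
        qed
        ultimately obtain N3 O3 where N3: "openin M N3" "openin P1 O3" "C \<subseteq> N3" "x \<in> O3"
            "N3 \<times> O3 \<subseteq> {p \<in> topspace (prod_topology M P1). h (fst p) (snd p) \<in> Q}"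
          using tube_lemma_left[OF openin_joint_preimage[OF h Q(1)], of C x] by auto
        have "\<forall>\<^sub>F t in at_top. \<gamma> t \<in> O3" using x(2) N3(2,4) by (simp add: limitin_def)
        then obtain T' where T': "\<And>t. t \<ge> T' \<Longrightarrow> \<gamma> t \<in> O3" unfolding eventually_at_top_linorder by blast
        have "norm (H z) < \<epsilon>" if z: "z \<in> S" "T' \<le> Re z" for z
        proof -
          have "Im z / 3 \<in> {0..1/3}" using z(1) by (auto simp: S_def)
          then have "\<sigma> (\<alpha> z) \<in> C" unfolding C_def \<alpha>_def by (intro imageI)
          moreover have "\<gamma> (T + Re z) \<in> O3" using T' T z(2) by simp
          ultimately have "(\<sigma> (\<alpha> z), \<gamma> (T + Re z)) \<in> N3 \<times> O3" using N3(3) by blast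
          then have "(\<sigma> (\<alpha> z), \<gamma> (T + Re z)) \<in> {p \<in> topspace (prod_topology M P1). h (fst p) (snd p) \<in> Q}"
            using N3(5) by blast
          then have "P z \<in> Q" by (simp add: P_def)
          then show ?thesis by (simp add: Q_def H_def dist_norm norm_minus_commute)
        qed
        then show ?thesis by blast
      qed
      have lim: "((\<lambda>t. F (H (Complex t s))) \<longlongrightarrow> d (g (\<sigma> (complex_of_real (s / 3))) v)) at_top"
        if s: "s \<in> {0, 1}" for s
      proof -
        define n where "n = \<sigma> (complex_of_real (s / 3))"
        have s3: "complex_of_real (s / 3) \<in> ball 0 1" using s by auto
        have nM: "n \<in> topspace M" and nN: "n \<in> N1" using NM[OF s3] \<sigma>N[OF s3] by (auto simp: n_def)
        have "continuous_map P1 P1 (\<lambda>z. g n z)"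
          using continuous_map_compose[OF _ g, of P1 "\<lambda>z. (n, z)"] nM
          by (simp add: o_def continuous_map_pairedI)
        moreover have "limitin P1 (\<lambda>t. f (\<gamma> (T + t))) v at_top"
        proof -
          have "filterlim (\<lambda>t. T + t) at_top (at_top :: real filter)"
            by (rule filterlim_tendsto_add_at_top[OF tendsto_const filterlim_ident])
          then show ?thesis using lim_v
            by (auto simp: limitin_def intro: eventually_compose_filterlim)
        qed
        ultimately have "limitin P1 (\<lambda>t. g n (f (\<gamma> (T + t)))) (g n v) at_top"
          using continuous_map_limit[of P1 P1 "\<lambda>z. g n z"] by (simp add: o_def)
        moreover have "g n v \<in> V" using N1(5)[OF nN N1(4)] B(3) by blast
        ultimately have "((\<lambda>t. d (g n (f (\<gamma> (T + t))))) \<longlongrightarrow> d (g n v)) at_top"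
          by (intro limitin_P1_chart[OF d(1)])
        moreover have "\<forall>\<^sub>F t in at_top. d (g n (f (\<gamma> (T + t)))) = F (H (Complex t s))"
          using eventually_ge_at_top[of 0]
        proof eventually_elim
          case (elim t)
          then have z: "Complex t s \<in> S" using s by (auto simp: S_def)
          show ?case using fP[OF z] Kc[OF PU[OF z]] by (simp add: F_def H_def n_def \<alpha>_def)
        qed
        ultimately show ?thesis unfolding n_def[symmetric] by (rule Lim_transform_eventually)
      qed
      have "d (g k v) = d (g m v)"
        by (rule lindelof_two_limits_homotopic[of H R F, folded S_def, OF contH openR HR zeroR holF bdF H0])
           (use lim[of 0] lim[of 1] \<sigma>(2,3) in auto)
      moreover have "g m v \<in> V" using N1(4,5) N(3) m B(3) by blast
      ultimately show ?thesis using d P1_chart_bij(1)[OF d(1)] by (auto simp: inj_on_def)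
    qed
    then show "\<exists>N. openin M N \<and> k \<in> N \<and> (\<forall>m\<in>N. g m v = g k v)" using N(1,2) by blast
  qed
  then show ?thesis using g0 by simp
qed

section \<open>Equality on the singular values\<close>

theorem proposition1p8:
  fixes M :: "'m topology"
    and \<A> :: "('m set \<times> ('m \<Rightarrow> complex ^ 'n)) set"
    and l0 :: 'm
    and W :: "complex option set"
    and f :: "complex option \<Rightarrow> complex option"
    and \<phi> \<psi> \<phi>' \<psi>' :: "'m \<Rightarrow> complex option \<Rightarrow> complex option"
  assumes "complex_manifold M \<A>" and "connected_space M" and "l0 \<in> topspace M"
    and "Ahlfors_island_map W f"
    and "totally_disconnected_in P1 (P1 frontier_of W)"
    and "holomorphic_qc_family M \<A> \<phi>" and "holomorphic_qc_family M \<A> \<psi>"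
    and "holomorphic_qc_family M \<A> \<phi>'" and "holomorphic_qc_family M \<A> \<psi>'"
    and same_base_point: "\<phi> l0 = \<phi>' l0"
    and same_domain: "\<And>l. l \<in> topspace M \<Longrightarrow> \<psi> l ` W = \<psi>' l ` W"
    and same_map: "\<And>l z. l \<in> topspace M \<Longrightarrow> z \<in> \<psi> l ` W \<Longrightarrow>
           (\<phi> l \<circ> f \<circ> inv (\<psi> l)) z = (\<phi>' l \<circ> f \<circ> inv (\<psi>' l)) z"
  shows "\<forall>l\<in>topspace M. \<forall>v\<in>singular_values W f. \<phi> l v = \<phi>' l v"
proof -
  define g where "g l z = inv (\<phi>' l) (\<phi> l z)" for l z
  define h where "h l z = inv (\<psi>' l) (\<psi> l z)" for l z
  have trans: "continuous_map (prod_topology M P1) P1 (\<lambda>(l, z). inv (b l) (a l z))"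
    if "holomorphic_qc_family M \<A> a" "holomorphic_qc_family M \<A> b" for a b
  proof -
    have "continuous_map (prod_topology M P1) (prod_topology M P1) (\<lambda>p. (fst p, (\<lambda>(l, z). a l z) p))"
      by (intro continuous_map_pairedI continuous_map_fst holomorphic_qc_family_continuous(1)[OF assms(1) that(1)])
    from continuous_map_compose[OF this holomorphic_qc_family_continuous(2)[OF assms(1) that(2)]]
    show ?thesis by (simp add: o_def case_prod_unfold)
  qed
  have cg: "continuous_map (prod_topology M P1) P1 (\<lambda>(l, z). g l z)"
    and ch: "continuous_map (prod_topology M P1) P1 (\<lambda>(l, z). h l z)"
    unfolding g_def h_def by (intro trans assms)+
  have f: "P1_holomorphic_on f W" using assms(4) by (simp add: Ahlfors_island_map_def)
  have bij: "bij (\<phi> l)" "bij (\<phi>' l)" "bij (\<psi> l)" "bij (\<psi>' l)" if "l \<in> topspace M" for l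
    using holomorphic_qc_family_homeomorphic(2)[OF assms(6) that] holomorphic_qc_family_homeomorphic(2)[OF assms(8) that]
      holomorphic_qc_family_homeomorphic(2)[OF assms(7) that] holomorphic_qc_family_homeomorphic(2)[OF assms(9) that] .
  have hom_h: "homeomorphic_map P1 P1 (h l)" if l: "l \<in> topspace M" for l
  proof -
    note hom = holomorphic_qc_family_homeomorphic(1)[OF _ l]
    obtain k where k: "homeomorphic_maps P1 P1 (\<psi>' l) k"
      using hom[OF assms(9)] homeomorphic_map_maps by blast
    then have "k = inv (\<psi>' l)" using bij(4)[OF l]
      by (metis (no_types, lifting) UNIV_I bij_inv_eq_iff ext homeomorphic_maps_def topspace_P1)
    then have "homeomorphic_map P1 P1 (inv (\<psi>' l))"
      using k homeomorphic_maps_map by blast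
    from homeomorphic_map_compose[OF hom[OF assms(7)] this] show ?thesis by (simp add: h_def[abs_def] o_def)
  qed
  have hW: "h l ` W = W" if l: "l \<in> topspace M" for l
  proof -
    have "h l ` W = inv (\<psi>' l) ` (\<psi> l ` W)" by (auto simp: h_def)
    also have "\<dots> = W" unfolding same_domain[OF l] using bij(4)[OF l] by (simp add: bij_is_inj image_inv_f_f)
    finally show ?thesis .
  qed
  have gf: "g l (f z) = f (h l z)" if l: "l \<in> topspace M" and z: "z \<in> W" for l z
  proof -
    have "\<phi> l (f (inv (\<psi> l) (\<psi> l z))) = \<phi>' l (f (h l z))"
      using same_map[OF l, of "\<psi> l z"] z by (simp add: h_def)
    then show ?thesis using bij[OF l] by (simp add: g_def bij_is_inj inv_f_f)
  qed
  have g0: "g l0 = id" using bij(2)[OF assms(3)] by (auto simp: g_def same_base_point bij_is_inj fun_eq_iff)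
  have inj_g: "inj (g l)" if l: "l \<in> topspace M" for l
    using inj_compose[OF bij_is_inj[OF bij_imp_bij_inv[OF bij(2)[OF l]]] bij_is_inj[OF bij(1)[OF l]]]
    by (simp add: g_def[abs_def] o_def)
  have fixed: "\<phi> l v = \<phi>' l v" if l: "l \<in> topspace M" and v: "v \<in> critical_values W f \<union> asymptotic_values W f" for l v
  proof -
    have "g l v = v"
      using v
    proof
      assume v_in: "v \<in> critical_values W f"
      show ?thesis
        by (rule critical_value_fixed[of f W M l0 h g v l];
            (rule f assms(2,3) ch hom_h hW inj_g g0 gf l v_in; assumption?))
    next
      assume v_in: "v \<in> asymptotic_values W f"
      show ?thesis
        by (rule asymptotic_value_fixed[of M \<A> l0 f W h g v l];
            (rule assms(1-3) f assms(5) ch cg hom_h hW g0 gf l v_in; assumption?))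
    qed
    then have "v = inv (\<phi>' l) (\<phi> l v)" by (simp add: g_def)
    then show ?thesis using bij_inv_eq_iff[OF bij(2)[OF l], of v "\<phi> l v"] by simp
  qed
  show ?thesis
  proof (intro ballI)
    fix l v assume l: "l \<in> topspace M" and "v \<in> singular_values W f"
    then obtain s where s: "range s \<subseteq> critical_values W f \<union> asymptotic_values W f" "limitin P1 s v sequentially"
      unfolding singular_values_def by blast
    have lim: "limitin P1 (\<lambda>n. k l (s n)) (k l v) sequentially" if "holomorphic_qc_family M \<A> k" for k
      using continuous_map_limit[OF homeomorphic_imp_continuous_map[OF
          holomorphic_qc_family_homeomorphic(1)[OF that l]] s(2)] by (simp add: o_def)
    have "(\<lambda>n. \<phi> l (s n)) = (\<lambda>n. \<phi>' l (s n))" using fixed[OF l] s(1) by blast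
    then show "\<phi> l v = \<phi>' l v"
      using limitin_Hausdorff_unique[OF lim[OF assms(6)] _ _ Hausdorff_space_P1, of "\<phi>' l v"] lim[OF assms(8)] by simp
  qed
qed

end
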